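(* Let $X$ be a nonzero complex Banach space with open unit ball $\mathbb{B}$, let $0\le\alpha<1$, let $g:\mathbb{B}\to\mathbb{C}$ be holomorphic with $g(0)=1$, and define $F(x)=g(x)x$ for $x\in\mathbb{B}$. Suppose that $F\in\mathcal{S}^*_{\mathbb{B}}(\alpha)$. Then for every $x_0\in X$ with $\|x_0\|=1$ and every $T_{x_0}\in T(x_0)$, $$|H_{2,2}(F)|=|A_2A_4-A_3^2|\le (1-\alpha)^2 .$$ Moreover, the estimate is sharp: for every nonzero complex Banach space $X$ and every $0\le\alpha<1$ there are a mapping $F\in\mathcal{S}^*_{\mathbb{B}}(\alpha)$ of the form $F(x)=g(x)x$ with $g:\mathbb{B}\to\mathbb{C}$ holomorphic and $g(0)=1$, a unit vector $x_0$ and $T_{x_0}\in T(x_0)$ for which equality $|A_2A_4-A_3^2|=(1-\alpha)^2$ holds.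
   Context: $X$ is a complex Banach space with norm $\|\cdot\|$ and $\mathbb{B}=\{x\in X:\|x\|<1\}$. For $x\in X\setminus\{0\}$, $T(x)$ is the (nonempty) set of bounded linear functionals $T_x:X\to\mathbb{C}$ with $\|T_x\|=1$ and $T_x(x)=\|x\|$. For holomorphic $F:\mathbb{B}\to X$, $DF(x)$ is the Fréchet derivative at $x$, $D^nF(x)$ is the $n$th Fréchet derivative (a bounded symmetric $n$-linear map $X^n\to X$). $F$ is normalized if $F(0)=0$ and $DF(0)=I$ (the identity), and locally biholomorphic if $DF(x)$ is invertible with bounded inverse for every $x\in\mathbb{B}$. Class $\mathcal{S}^*_{\mathbb{B}}(\alpha)$ (starlike mappings of order $\alpha$): for $0<\alpha<1$, the set of normalized locally biholomorphic $F:\mathbb{B}\to X$ such that $$\left|\frac{1}{\|x\|}T_x\big((DF(x))^{-1}F(x)\big)-\frac{1}{2\alpha}\right|<\frac{1}{2\alpha}\quad\text{for all }x\in\mathbb{B}\setminus\{0\},\ T_x\in T(x);$$ equivalently, $\operatorname{Re}\big(\|x\|/T_x((DF(x))^{-1}F(x))\big)>\alpha$ for all such $x,T_x$. For $\alpha=0$, $\mathcal{S}^*_{\mathbb{B}}(0)=\mathcal{S}^*_{\mathbb{B}}$ is the set of normalized locally biholomorphic $F$ with $\operatorname{Re}\,T_x((DF(x))^{-1}F(x))>0$ for all $x\in\mathbb{B}\setminus\{0\}$, $T_x\in T(x)$. Given $x_0$ with $\|x_0\|=1$ and $T_{x_0}\in T(x_0)$, put $A_n=\frac{1}{n!}T_{x_0}\big(D^nF(0)(x_0,\ldots,x_0)\big)$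 ($x_0$ repeated $n$ times) for $n=2,3,4$. *)

theory Defs
  imports "HOL-Analysis.Analysis"
begin

text \<open>
  HOL-Analysis only has real Banach spaces. A complex one is a real one with a
  compatible complex scalar multiplication.
\<close>

class complex_normed_space = real_normed_vector +
  fixes scaleC :: "complex \<Rightarrow> 'a \<Rightarrow> 'a"  (infixr "*\<^sub>C" 75)
  assumes scaleC_add_right: "c *\<^sub>C (x + y) = c *\<^sub>C x + c *\<^sub>C y"
    and scaleC_add_left: "(c + d) *\<^sub>C x = c *\<^sub>C x + d *\<^sub>C x"
    and scaleC_scaleC: "c *\<^sub>C d *\<^sub>C x = (c * d) *\<^sub>C x"
    and scaleC_of_real: "complex_of_real r *\<^sub>C x = r *\<^sub>R x"
    and norm_scaleC: "norm (c *\<^sub>C x) = cmod c * norm x"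

class complex_banach = complex_normed_space + banach

instantiation complex :: complex_banach
begin

definition scaleC_complex :: "complex \<Rightarrow> complex \<Rightarrow> complex"
  where "scaleC_complex = (*)"

instance
  by standard (simp_all add: scaleC_complex_def algebra_simps norm_mult scaleR_conv_of_real)

end

definition frechet_holomorphic_on ::
    "('a::complex_normed_space \<Rightarrow> 'b::complex_normed_space) \<Rightarrow> 'a set \<Rightarrow> bool"
  where "frechet_holomorphic_on f S \<longleftrightarrow>
    (\<forall>x\<in>S. \<exists>D. (f has_derivative D) (at x) \<and> (\<forall>c v. D (c *\<^sub>C v) = c *\<^sub>C D v))"

text \<open>
  The Frechet derivative as a map into the space of bounded linear maps, so that it can
  be iterated: \<open>fderiv (fderiv f) x u v\<close> is the second derivative of \<open>f\<close> at \<open>x\<close>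
  applied to \<open>(u, v)\<close>, and so on. The type \<open>\<Rightarrow>\<^sub>L\<close> consists of the bounded
  real-linear maps, but for a holomorphic function the derivatives over the reals and over
  the complex numbers coincide, and the operator norm of a complex-linear map does not
  depend on the scalar field.
\<close>

definition fderiv :: "('a::real_normed_vector \<Rightarrow> 'b::real_normed_vector) \<Rightarrow> 'a \<Rightarrow> 'a \<Rightarrow>\<^sub>L 'b"
  where "fderiv f x = Blinfun (frechet_derivative f (at x))"

text \<open>The set \<open>T(x)\<close> of support functionals; it is only used for \<open>x \<noteq> 0\<close>.\<close>

definition support_functionals :: "'a::complex_normed_space \<Rightarrow> ('a \<Rightarrow>\<^sub>L complex) set"
  where "support_functionals x =
    {T. (\<forall>c v. blinfun_apply T (c *\<^sub>C v) = c * blinfun_apply T v) \<and> norm T = 1 \<and>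
        blinfun_apply T x = complex_of_real (norm x)}"

text \<open>
  Mappings of the unit ball are total functions; only their values on
  \<open>ball 0 1\<close> matter below.
\<close>

definition normalized :: "('a::complex_banach \<Rightarrow> 'a) \<Rightarrow> bool"
  where "normalized F \<longleftrightarrow> F 0 = 0 \<and> fderiv F 0 = id_blinfun"

definition locally_biholomorphic :: "('a::complex_banach \<Rightarrow> 'a) \<Rightarrow> bool"
  where "locally_biholomorphic F \<longleftrightarrow>
    frechet_holomorphic_on F (ball 0 1) \<and>
    (\<forall>x\<in>ball 0 1. \<exists>G. G o\<^sub>L fderiv F x = id_blinfun \<and> fderiv F x o\<^sub>L G = id_blinfun)"

definition starlike_maps :: "real \<Rightarrow> ('a::complex_banach \<Rightarrow> 'a) set"
  where "starlike_maps \<alpha> =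
    {F. normalized F \<and> locally_biholomorphic F \<and>
        (\<forall>x \<in> ball 0 1 - {0}. \<forall>T \<in> support_functionals x.
          let w = blinfun_apply T (inv (blinfun_apply (fderiv F x)) (F x)) in
          if \<alpha> = 0 then Re w > 0
          else cmod (w / of_real (norm x) - of_real (1 / (2 * \<alpha>))) < 1 / (2 * \<alpha>))}"

definition A2 :: "('a::complex_banach \<Rightarrow> 'a) \<Rightarrow> ('a \<Rightarrow>\<^sub>L complex) \<Rightarrow> 'a \<Rightarrow> complex"
  where "A2 F T u = blinfun_apply T (fderiv (fderiv F) 0 u u) / fact 2"

definition A3 :: "('a::complex_banach \<Rightarrow> 'a) \<Rightarrow> ('a \<Rightarrow>\<^sub>L complex) \<Rightarrow> 'a \<Rightarrow> complex"
  where "A3 F T u = blinfun_apply T (fderiv (fderiv (fderiv F)) 0 u u u) / fact 3"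

definition A4 :: "('a::complex_banach \<Rightarrow> 'a) \<Rightarrow> ('a \<Rightarrow>\<^sub>L complex) \<Rightarrow> 'a \<Rightarrow> complex"
  where "A4 F T u = blinfun_apply T (fderiv (fderiv (fderiv (fderiv F))) 0 u u u u) / fact 4"

definition H22 :: "('a::complex_banach \<Rightarrow> 'a) \<Rightarrow> ('a \<Rightarrow>\<^sub>L complex) \<Rightarrow> 'a \<Rightarrow> complex"
  where "H22 F T u = A2 F T u * A4 F T u - (A3 F T u)\<^sup>2"

end

(*
A radial mapping F(x) = g(x) x restricts, along the complex line through a unit vector u, to the
function f(z) = z p(z) with p(z) = g(z u). The values T(D^nF(0)(u, ..., u)) / n! are the Taylor
coefficients of f, and the starlikeness condition becomes Re(z f'(z) / f(z)) > alpha. With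
beta = 1 - alpha one has z f' / f = 1 + 2 beta w / (1 - w) for a Schwarz function
w = w1 z + w2 z^2 + w3 z^3 + ..., and comparing coefficients

  A2 A4 - A3^2 = beta^2 ((4/3) w1 w3 + (2/3) w1^2 w2 - w2^2 + (1 - 4 beta^2) / 3 * w1^4).

The Schur parametrization w1 = a, w2 = (1 - |a|^2) b, w3 = (1 - |a|^2) ((1 - |b|^2) c - conj(a) b^2)
in the closed unit disc bounds the bracket by 1. Equality holds for w = z^2, which corresponds to
g(x) = (1 - T(x)^2)^(-beta) for a support functional T of a unit vector.
*)
theory Submission
  imports Defs "HOL-Complex_Analysis.Complex_Analysis"
begin

text \<open>\<open>A2\<close>, \<open>A3\<close> and \<open>A4\<close> are built from iterated
  Frechet derivatives, whereas \<open>frechet_holomorphic_on\<close> provides only a first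
  derivative. The main obstacle is therefore to show that the higher derivatives exist and yield the
  Taylor coefficients on a line. Cauchy theory for vector-valued maps is reduced to scalar functions
  of one variable through functionals that recover the norm. Since \<open>fderiv\<close> takes its
  values in real operator spaces, these functionals are real-linear maps into the complex numbers,
  and complex differentiability is required of their composites with complex lines in the domain; in
  this form the argument passes from a map to its derivative. Hahn-Banach supplies the initial
  functionals. It also supplies the support functional without which the starlikeness condition
  would be vacuous at a point, and the one from which the extremal mapping is built.\<close>

section \<open>Complex scalar multiplication and complex lines\<close>

lemma bounded_bilinear_scaleC: "bounded_bilinear ((*\<^sub>C) :: complex \<Rightarrow> 'a::complex_normed_space \<Rightarrow> 'a)"
proof
  fix a b :: complex and x y :: 'a and r :: real
  show "(a + b) *\<^sub>C x = a *\<^sub>C x + b *\<^sub>C x" "a *\<^sub>C (x + y) = a *\<^sub>C x + a *\<^sub>C y"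
    by (simp_all add: scaleC_add_left scaleC_add_right)
  show "(r *\<^sub>R a) *\<^sub>C x = r *\<^sub>R (a *\<^sub>C x)" "a *\<^sub>C (r *\<^sub>R x) = r *\<^sub>R (a *\<^sub>C x)"
    by (simp_all add: scaleR_conv_of_real scaleC_scaleC mult.commute flip: scaleC_of_real)
  show "\<exists>K. \<forall>a (x::'a). norm (a *\<^sub>C x) \<le> norm a * norm x * K"
    by (rule exI[of _ 1]) (simp add: norm_scaleC)
qed

interpretation scaleC: bounded_bilinear "(*\<^sub>C) :: complex \<Rightarrow> 'a::complex_normed_space \<Rightarrow> 'a"
  by (rule bounded_bilinear_scaleC)

lemma scaleC_one [simp]: "1 *\<^sub>C x = (x::'a::complex_normed_space)"
  using scaleC_of_real[of 1 x] by simp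

lemma continuous_on_scaleC_line: "continuous_on A (\<lambda>z. y + z *\<^sub>C (v::'a::complex_normed_space))"
  by (intro continuous_intros scaleC.continuous_on)

lemma open_complex_line:
  fixes y v :: "'a::complex_normed_space"
  assumes "open S"
  shows "open {z. y + z *\<^sub>C v \<in> S}"
  using open_vimage[OF assms continuous_on_scaleC_line[of UNIV y v]] by (simp add: vimage_def)

section \<open>Support functionals\<close>

definition sublinear :: "('a::real_vector \<Rightarrow> real) \<Rightarrow> bool"
  where "sublinear p \<longleftrightarrow> (\<forall>x y. p (x + y) \<le> p x + p y) \<and> (\<forall>t x. 0 \<le> t \<longrightarrow> p (t *\<^sub>R x) = t * p x)"

lemma sublinear_add: "sublinear p \<Longrightarrow> p (x + y) \<le> p x + p y"
  and sublinear_scale: "sublinear p \<Longrightarrow> 0 \<le> t \<Longrightarrow> p (t *\<^sub>R x) = t * p x"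
  by (auto simp: sublinear_def)

lemma sublinear_minus_le: "sublinear p \<Longrightarrow> - p (- x) \<le> p x"
  using sublinear_add[of p x "-x"] sublinear_scale[of p 0 0] by simp

text \<open>A sublinear functional can be lowered in a direction \<open>y\<close> until it is additive along \<open>y\<close>.\<close>

definition lower_along :: "'a::real_vector \<Rightarrow> ('a \<Rightarrow> real) \<Rightarrow> 'a \<Rightarrow> real"
  where "lower_along y p x = (INF t\<in>{0..}. p (x + t *\<^sub>R y) - t * p y)"

context
  fixes p :: "'a::real_vector \<Rightarrow> real" and y :: 'a
  assumes p: "sublinear p"
begin

lemma lower_along_bdd: "bdd_below ((\<lambda>t. p (x + t *\<^sub>R y) - t * p y) ` {0..})"
proof (rule bdd_belowI2[where m = "- p (- x)"])
  fix t :: real assume "t \<in> {0..}"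
  then have "t * p y = p (t *\<^sub>R y)" using sublinear_scale[OF p] by simp
  also have "\<dots> \<le> p (x + t *\<^sub>R y) + p (- x)"
    using sublinear_add[OF p, of "x + t *\<^sub>R y" "- x"] by simp
  finally show "- p (- x) \<le> p (x + t *\<^sub>R y) - t * p y" by simp
qed

lemma lower_along_le: "0 \<le> t \<Longrightarrow> lower_along y p x \<le> p (x + t *\<^sub>R y) - t * p y"
  unfolding lower_along_def by (rule cINF_lower[OF lower_along_bdd]) simp

lemma lower_along_ge: "(\<And>t. 0 \<le> t \<Longrightarrow> c \<le> p (x + t *\<^sub>R y) - t * p y) \<Longrightarrow> c \<le> lower_along y p x"
  unfolding lower_along_def by (rule cINF_greatest) auto

lemma sublinear_lower_along: "sublinear (lower_along y p)"
  unfolding sublinear_def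
proof (intro conjI allI impI)
  fix u v :: 'a
  \<comment> \<open>A parameter t for u and a parameter s for v combine to t + s for u + v. Fixing s
    first handles the two infima one after the other.\<close>
  have "lower_along y p (u + v) - (p (v + s *\<^sub>R y) - s * p y) \<le> lower_along y p u" if "0 \<le> s" for s
  proof (rule lower_along_ge)
    fix t :: real assume "0 \<le> t"
    have "lower_along y p (u + v) \<le> p ((u + v) + (t + s) *\<^sub>R y) - (t + s) * p y"
      using \<open>0 \<le> t\<close> \<open>0 \<le> s\<close> by (intro lower_along_le) simp
    also have "p ((u + v) + (t + s) *\<^sub>R y) \<le> p (u + t *\<^sub>R y) + p (v + s *\<^sub>R y)"
      using sublinear_add[OF p, of "u + t *\<^sub>R y" "v + s *\<^sub>R y"] by (simp add: algebra_simps)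
    finally show "lower_along y p (u + v) - (p (v + s *\<^sub>R y) - s * p y) \<le> p (u + t *\<^sub>R y) - t * p y"
      by (simp add: algebra_simps)
  qed
  then have "lower_along y p (u + v) - lower_along y p u \<le> lower_along y p v"
    by (intro lower_along_ge) (simp add: algebra_simps)
  then show "lower_along y p (u + v) \<le> lower_along y p u + lower_along y p v" by simp
next
  fix t :: real and x :: 'a assume "0 \<le> t"
  show "lower_along y p (t *\<^sub>R x) = t * lower_along y p x"
  proof (cases "t = 0")
    case True
    have "lower_along y p 0 = 0"
    proof (rule antisym)
      show "lower_along y p 0 \<le> 0"
        using lower_along_le[of 0 0] sublinear_scale[OF p, of 0 0] by simp
      show "0 \<le> lower_along y p 0"
        by (rule lower_along_ge) (simp add: sublinear_scale[OF p])
    qed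
    then show ?thesis using True by simp
  next
    case False
    with \<open>0 \<le> t\<close> have t: "t > 0" by simp
    \<comment> \<open>For t > 0 the substitution s -> t * s permutes the nonnegative parameters, so
      the infimum scales by t.\<close>
    have eq: "p (t *\<^sub>R x + (t * s) *\<^sub>R y) - (t * s) * p y = t * (p (x + s *\<^sub>R y) - s * p y)" for s
      using sublinear_scale[OF p \<open>0 \<le> t\<close>, of "x + s *\<^sub>R y"] by (simp add: algebra_simps)
    show ?thesis
    proof (rule antisym)
      have "lower_along y p (t *\<^sub>R x) / t \<le> lower_along y p x"
      proof (rule lower_along_ge)
        fix s :: real assume "0 \<le> s"
        then show "lower_along y p (t *\<^sub>R x) / t \<le> p (x + s *\<^sub>R y) - s * p y"
          using lower_along_le[of "t * s" "t *\<^sub>R x"] eq[of s] t by (simp add: divide_simps mult.commute)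
      qed
      then show "lower_along y p (t *\<^sub>R x) \<le> t * lower_along y p x"
        using t by (simp add: divide_simps mult.commute)
      show "t * lower_along y p x \<le> lower_along y p (t *\<^sub>R x)"
      proof (rule lower_along_ge)
        fix s :: real assume "0 \<le> s"
        then have "lower_along y p x \<le> p (x + (s / t) *\<^sub>R y) - (s / t) * p y"
          using t by (intro lower_along_le) simp
        then have "t * lower_along y p x \<le> t * (p (x + (s / t) *\<^sub>R y) - (s / t) * p y)"
          using t by (intro mult_left_mono) auto
        also have "\<dots> = p (t *\<^sub>R x + s *\<^sub>R y) - s * p y"
          using eq[of "s / t"] t by simp
        finally show "t * lower_along y p x \<le> p (t *\<^sub>R x + s *\<^sub>R y) - s * p y" .
      qed
    qed
  qed
qed

end

text \<open>An infimum of sublinear functionals need not be subadditive. In a chain, however, any p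
  and q have a common lower member r, and r (x + y) \<le> r x + r y \<le> p x + q y. The pointwise
  lower bounds make the real infima meaningful.\<close>

lemma sublinear_INF:
  fixes C :: "('a::real_vector \<Rightarrow> real) set"
  assumes ne: "C \<noteq> {}" and sub: "\<And>p. p \<in> C \<Longrightarrow> sublinear p"
    and chain: "\<And>p q. p \<in> C \<Longrightarrow> q \<in> C \<Longrightarrow> p \<le> q \<or> q \<le> p"
    and bdd: "\<And>x. bdd_below ((\<lambda>p. p x) ` C)"
  shows "sublinear (\<lambda>x. INF p\<in>C. p x)"
  unfolding sublinear_def
proof (intro conjI allI impI)
  fix x y :: 'a
  have "(INF p\<in>C. p (x + y)) - q y \<le> (INF p\<in>C. p x)" if q: "q \<in> C" for q
  proof (rule cINF_greatest[OF ne])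
    fix p assume p: "p \<in> C"
    obtain r where r: "r \<in> C" "r \<le> p" "r \<le> q"
      using chain[OF p q] p q by blast
    have "(INF p\<in>C. p (x + y)) \<le> r (x + y)" by (rule cINF_lower[OF bdd r(1)])
    also have "\<dots> \<le> r x + r y" by (rule sublinear_add[OF sub[OF r(1)]])
    also have "\<dots> \<le> p x + q y" using r by (intro add_mono) (auto dest: le_funD)
    finally show "(INF p\<in>C. p (x + y)) - q y \<le> p x" by simp
  qed
  then have "(INF p\<in>C. p (x + y)) - (INF p\<in>C. p x) \<le> (INF q\<in>C. q y)"
    by (intro cINF_greatest[OF ne]) (simp add: algebra_simps)
  then show "(INF p\<in>C. p (x + y)) \<le> (INF p\<in>C. p x) + (INF p\<in>C. p y)" by simp
next
  fix t :: real and x :: 'a assume "0 \<le> t"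
  have "(INF p\<in>C. p (t *\<^sub>R x)) = (INF p\<in>C. t * p x)"
    by (rule INF_cong) (auto simp: sublinear_scale[OF sub] \<open>0 \<le> t\<close>)
  also have "\<dots> = t * (INF p\<in>C. p x)"
  proof (cases "t = 0")
    case False
    with \<open>0 \<le> t\<close> have t: "t > 0" by simp
    show ?thesis
    proof (rule antisym)
      have b: "bdd_below ((\<lambda>p. t * p x) ` C)"
        using bdd_below_image_mono[OF monoI[of "\<lambda>z. t * z"] bdd[of x]] t
        by (simp add: image_image mult_left_mono)
      have "(INF p\<in>C. t * p x) / t \<le> (INF p\<in>C. p x)"
        by (rule cINF_greatest[OF ne]) (use t cINF_lower[OF b] in \<open>simp add: divide_simps mult.commute\<close>)
      then show "(INF p\<in>C. t * p x) \<le> t * (INF p\<in>C. p x)"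
        using t by (simp add: divide_simps mult.commute)
      show "t * (INF p\<in>C. p x) \<le> (INF p\<in>C. t * p x)"
        by (rule cINF_greatest[OF ne]) (use t in \<open>simp add: cINF_lower[OF bdd]\<close>)
    qed
  qed (use ne in simp)
  finally show "(INF p\<in>C. p (t *\<^sub>R x)) = t * (INF p\<in>C. p x)" .
qed

text \<open>A minimal sublinear functional below \<open>p\<close> coincides with all its lowerings and is therefore linear.\<close>

lemma ex_linear_le_sublinear:
  fixes p :: "'a::real_vector \<Rightarrow> real"
  assumes p: "sublinear p"
  obtains l where "linear l" "\<And>x. l x \<le> p x"
proof -
  define A where "A = {q. sublinear q \<and> q \<le> p}"
  \<comment> \<open>The order is reversed: Zorn's lemma gives maximal elements, and a minimal
    functional is wanted.\<close>
  define P where "P = (\<lambda>q r :: 'a \<Rightarrow> real. r \<le> q)"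
  have ch: "\<exists>u\<in>A. \<forall>q\<in>C. P q u" if C: "C \<in> Chains (relation_of P A)" for C
  proof (cases "C = {}")
    case True
    then show ?thesis using p by (auto simp: A_def)
  next
    case False
    have CA: "q \<in> A" if "q \<in> C" for q
      using C that by (auto simp: Chains_def relation_of_def)
    have bdd: "bdd_below ((\<lambda>q. q x) ` C)" for x
    proof (rule bdd_belowI2[where m = "- p (- x)"])
      fix q assume "q \<in> C"
      then have "sublinear q" "q (- x) \<le> p (- x)"
        using CA[of q] by (auto simp: A_def le_fun_def)
      then show "- p (- x) \<le> q x"
        using sublinear_minus_le[of q x] by simp
    qed
    have "sublinear (\<lambda>x. INF q\<in>C. q x)"
      by (rule sublinear_INF[OF False _ _ bdd])
        (use CA C in \<open>auto simp: A_def Chains_def relation_of_def P_def\<close>)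
    moreover have "(\<lambda>x. INF q\<in>C. q x) \<le> q" if "q \<in> C" for q
      using cINF_lower[OF bdd that] by (simp add: le_fun_def)
    moreover from this have "(\<lambda>x. INF q\<in>C. q x) \<le> p"
      using False CA by (fastforce simp: A_def intro: order_trans)
    ultimately show ?thesis by (auto simp: A_def P_def)
  qed
  have "partial_order_on A (relation_of P A)"
    by (rule partial_order_on_relation_ofI) (auto simp: P_def)
  from predicate_Zorn[OF this ch]
  obtain m where m: "m \<in> A" and minm: "\<And>q. q \<in> A \<Longrightarrow> q \<le> m \<Longrightarrow> q = m"
    by (auto simp: P_def)
  from m have sm: "sublinear m" and mp: "m \<le> p" by (auto simp: A_def)
  have add: "m (x + y) = m x + m y" for x y
  proof -
    have "lower_along y m \<le> m"
      using lower_along_le[OF sm, of 0] by (simp add: le_fun_def)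
    then have "lower_along y m = m"
      using minm sublinear_lower_along[OF sm] mp by (auto simp: A_def)
    \<comment> \<open>The parameter t = 1 in the lowering gives the converse of
      subadditivity.\<close>
    then have "m x \<le> m (x + y) - m y"
      using lower_along_le[OF sm, of 1 y x] by simp
    then show ?thesis using sublinear_add[OF sm, of x y] by simp
  qed
  have neg: "m (- x) = - m x" for x
    using add[of x "- x"] sublinear_scale[OF sm, of 0 0] by simp
  have "linear m"
  proof (rule linearI)
    fix r :: real and x
    show "m (r *\<^sub>R x) = r *\<^sub>R m x"
      using sublinear_scale[OF sm, of r x] sublinear_scale[OF sm, of "- r" x] neg[of "r *\<^sub>R x"]
      by (cases "0 \<le> r") auto
  qed (rule add)
  with mp show ?thesis by (intro that[of m]) (auto simp: le_fun_def)
qed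

text \<open>Lowering the norm along u beforehand replaces the extension from the line through u: the
  parameter t = 1 gives l (- u) \<le> - norm u, which together with l u \<le> norm u forces
  equality.\<close>

lemma ex_linear_le_norm:
  fixes u :: "'a::real_normed_vector"
  obtains l where "linear l" "\<And>x. l x \<le> norm x" "l u = norm u"
proof -
  have s: "sublinear (norm :: 'a \<Rightarrow> real)"
    by (simp add: sublinear_def norm_triangle_ineq)
  obtain l where l: "linear l" "\<And>x. l x \<le> lower_along u norm x"
    using ex_linear_le_sublinear[OF sublinear_lower_along[OF s]] by blast
  have le: "l x \<le> norm x" for x
    using l(2)[of x] lower_along_le[OF s, of 0 u x] by simp
  have "l (- u) \<le> - norm u"
    using l(2)[of "- u"] lower_along_le[OF s, of 1 u "- u"] by simp
  then have "l u = norm u"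
    using le[of u] linear_neg[OF l(1), of u] by simp
  with l(1) le show ?thesis by (rule that)
qed

lemma support_functionals_nonempty:
  fixes u :: "'a::complex_normed_space"
  assumes "u \<noteq> 0"
  shows "support_functionals u \<noteq> {}"
proof -
  obtain l where l: "linear l" and le: "\<And>x. l x \<le> norm x" and lu: "l u = norm u"
    using ex_linear_le_norm[of u] by blast
  \<comment> \<open>A complex-linear map is determined by its real part l through T x = l x - \<i> l
    (\<i> x).\<close>
  define T where "T x = Complex (l x) (- l (\<i> *\<^sub>C x))" for x
  have scaleC_eq: "c *\<^sub>C x = Re c *\<^sub>R x + Im c *\<^sub>R (\<i> *\<^sub>C x)" for c and x :: 'a
  proof -
    have "c *\<^sub>C x = (of_real (Re c) + of_real (Im c) * \<i>) *\<^sub>C x"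
      by (metis complex_eq mult.commute)
    then show ?thesis by (simp add: scaleC_add_left scaleC_of_real flip: scaleC_scaleC)
  qed
  have TC: "T (c *\<^sub>C x) = c * T x" for c x
  proof -
    have 1: "l (c *\<^sub>C x) = Re c * l x + Im c * l (\<i> *\<^sub>C x)"
      by (subst scaleC_eq) (simp add: linear_add[OF l] linear_scale[OF l])
    have "\<i> *\<^sub>C c *\<^sub>C x = Re c *\<^sub>R (\<i> *\<^sub>C x) + Im c *\<^sub>R (\<i> *\<^sub>C \<i> *\<^sub>C x)"
      by (subst scaleC_eq[of c]) (simp add: scaleC_add_right scaleC.scaleR_right)
    also have "\<i> *\<^sub>C \<i> *\<^sub>C x = - x"
      by (simp add: scaleC_scaleC scaleC.minus_left)
    finally have 2: "l (\<i> *\<^sub>C c *\<^sub>C x) = Re c * l (\<i> *\<^sub>C x) - Im c * l x"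
      by (simp add: linear_diff[OF l] linear_scale[OF l])
    show ?thesis by (simp add: T_def 1 2 complex_eq_iff)
  qed
  have Tn: "cmod (T x) \<le> norm x" for x
  proof (cases "T x = 0")
    case False
    \<comment> \<open>A unimodular rotation of x makes the value of T real and nonnegative, so the
      bound on the real part l suffices.\<close>
    define c where "c = cnj (T x) / cmod (T x)"
    have c: "cmod c = 1" using False by (simp add: c_def norm_divide)
    have "c * T x = cmod (T x)"
      using False complex_norm_square[of "T x"] by (simp add: c_def field_simps power2_eq_square)
    then have "cmod (T x) = Re (T (c *\<^sub>C x))" by (simp add: TC)
    also have "\<dots> \<le> norm (c *\<^sub>C x)" by (simp add: T_def le)
    finally show ?thesis by (simp add: norm_scaleC c)
  qed simp
  have bl: "bounded_linear T"
  proof (rule bounded_linear_intro[where K = 1])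
    fix x y r
    show "T (x + y) = T x + T y"
      by (simp add: T_def complex_eq_iff scaleC_add_right linear_add[OF l])
    show "T (r *\<^sub>R x) = r *\<^sub>R T x"
      using TC[of "of_real r" x] by (simp add: scaleC_of_real scaleR_conv_of_real)
    show "cmod (T x) \<le> norm x * 1" using Tn by simp
  qed
  have Tu: "T u = norm u"
  proof -
    have "Re (T u) = norm u" by (simp add: T_def lu)
    \<comment> \<open>The real part already exhausts the bound cmod (T u) \<le> norm u.\<close>
    moreover from this have "Im (T u) = 0"
      using Tn[of u] cmod_power2[of "T u"] power_mono[OF Tn[of u], of 2] by simp
    ultimately show ?thesis by (simp add: complex_eq_iff)
  qed
  have "norm (Blinfun T) = 1"
  proof (rule antisym)
    show "norm (Blinfun T) \<le> 1"
      by (rule norm_blinfun_bound) (simp_all add: bounded_linear_Blinfun_apply[OF bl] Tn)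
    have "norm u \<le> norm (Blinfun T) * norm u"
      using norm_blinfun[of "Blinfun T" u] by (simp add: bounded_linear_Blinfun_apply[OF bl] Tu)
    then show "1 \<le> norm (Blinfun T)" using assms by simp
  qed
  then have "Blinfun T \<in> support_functionals u"
    by (simp add: support_functionals_def bounded_linear_Blinfun_apply[OF bl] TC Tu)
  then show ?thesis by blast
qed

section \<open>Holomorphy of the derivative\<close>

text \<open>
  A function that is tested along complex lines against a norming set of functionals obeys
  the Cauchy estimates, which give existence and holomorphy of its Frechet derivative. The
  functionals on the space of operators are the evaluations followed by functionals on the
  target, so that the argument can be iterated.
\<close>

definition norming :: "('b::real_normed_vector \<Rightarrow> complex) set \<Rightarrow> bool"
  where "norming N \<longleftrightarrow> (\<forall>T\<in>N. linear T \<and> (\<forall>y. cmod (T y) \<le> norm y)) \<and>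
    (\<forall>y B. (\<forall>T\<in>N. cmod (T y) \<le> B) \<longrightarrow> norm y \<le> B)"

lemma norming_linear: "norming N \<Longrightarrow> T \<in> N \<Longrightarrow> linear T"
  and norming_le: "norming N \<Longrightarrow> T \<in> N \<Longrightarrow> cmod (T y) \<le> norm y"
  and norming_bound: "norming N \<Longrightarrow> (\<And>T. T \<in> N \<Longrightarrow> cmod (T y) \<le> B) \<Longrightarrow> norm y \<le> B"
  by (auto simp: norming_def)

lemma norming_bounded_linear: "norming N \<Longrightarrow> T \<in> N \<Longrightarrow> bounded_linear T"
  by (rule bounded_linear_intro[where K = 1])
    (auto simp: norming_le linear_add linear_scale dest: norming_linear)

definition gateaux_holomorphic_on ::
    "('b \<Rightarrow> complex) set \<Rightarrow> ('a::complex_normed_space \<Rightarrow> 'b::real_normed_vector) \<Rightarrow> 'a set \<Rightarrow> bool"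
  where "gateaux_holomorphic_on N f S \<longleftrightarrow>
    (\<forall>T\<in>N. \<forall>y v. (\<lambda>z. T (f (y + z *\<^sub>C v))) holomorphic_on {z. y + z *\<^sub>C v \<in> S})"

text \<open>Local boundedness is added because holomorphy along lines does not imply continuity in
  infinite dimension: a discontinuous complex-linear map is a counterexample. It provides the M of
  the Cauchy estimates.\<close>

definition weakly_holomorphic_on ::
    "('b \<Rightarrow> complex) set \<Rightarrow> ('a::complex_normed_space \<Rightarrow> 'b::real_normed_vector) \<Rightarrow> 'a set \<Rightarrow> bool"
  where "weakly_holomorphic_on N f S \<longleftrightarrow> gateaux_holomorphic_on N f S \<and>
    (\<forall>x\<in>S. \<exists>R>0. \<exists>M. \<forall>y\<in>ball x R. norm (f y) \<le> M)"

lemma gateaux_holomorphicD: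
  "gateaux_holomorphic_on N f S \<Longrightarrow> T \<in> N \<Longrightarrow>
    (\<lambda>z. T (f (y + z *\<^sub>C v))) holomorphic_on {z. y + z *\<^sub>C v \<in> S}"
  by (simp add: gateaux_holomorphic_on_def)

lemma gateaux_holomorphic_on_subset:
  "gateaux_holomorphic_on N f S \<Longrightarrow> A \<subseteq> S \<Longrightarrow> gateaux_holomorphic_on N f A"
  unfolding gateaux_holomorphic_on_def by (blast intro: holomorphic_on_subset)

lemma gateaux_holomorphic_on_difference:
  assumes "norming N" "gateaux_holomorphic_on N f S"
    and "\<And>u. u \<in> A \<Longrightarrow> u \<in> S" "\<And>u. u \<in> A \<Longrightarrow> u + k \<in> S"
  shows "gateaux_holomorphic_on N (\<lambda>u. f (u + k) - f u) A"
  unfolding gateaux_holomorphic_on_def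
proof (intro ballI allI)
  fix T y v assume T: "T \<in> N"
  have "(\<lambda>z. T (f ((y + k) + z *\<^sub>C v)) - T (f (y + z *\<^sub>C v))) holomorphic_on {z. y + z *\<^sub>C v \<in> A}"
    using assms(3) assms(4)[of "y + _ *\<^sub>C v"]
    by (intro holomorphic_intros gateaux_holomorphicD[OF assms(2) T, THEN holomorphic_on_subset])
      (auto simp: ac_simps)
  then show "(\<lambda>z. T (f (y + z *\<^sub>C v + k) - f (y + z *\<^sub>C v))) holomorphic_on {z. y + z *\<^sub>C v \<in> A}"
    by (simp add: linear_diff[OF norming_linear[OF assms(1) T]] add_ac)
qed

text \<open>Discs of radius \<rho> / 2 about points of the half disc stay in the domain, so Cauchy's
  inequality bounds the derivatives there uniformly, and Taylor's formula gives the rest. The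
  constant 8 is 2! * 2^2; the remainder is divided by 1!.\<close>

lemma cauchy_estimates:
  assumes hol: "f holomorphic_on ball 0 \<rho>" and "0 < \<rho>"
    and B: "\<forall>z\<in>ball 0 \<rho>. cmod (f z) \<le> M"
  shows "cmod (deriv f 0) \<le> 2 * M / \<rho>"
    and "cmod z < \<rho> / 2 \<Longrightarrow> cmod (f z - f 0) \<le> 2 * M / \<rho> * cmod z"
    and "cmod z < \<rho> / 2 \<Longrightarrow> cmod (f z - f 0 - z * deriv f 0) \<le> 8 * M / \<rho>\<^sup>2 * (cmod z)\<^sup>2"
proof -
  have sub: "cball w (\<rho> / 2) \<subseteq> ball 0 \<rho>" if "w \<in> ball 0 (\<rho> / 2)" for w :: complex
  proof
    fix x assume "x \<in> cball w (\<rho> / 2)"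
    then show "x \<in> ball 0 \<rho>"
      using that norm_triangle_ineq2[of x w] by (simp add: dist_norm norm_minus_commute)
  qed
  have C: "cmod ((deriv ^^ n) f w) \<le> fact n * M / (\<rho> / 2) ^ n" if w: "w \<in> ball 0 (\<rho> / 2)" for n w
  proof (rule Cauchy_inequality)
    show "f holomorphic_on ball w (\<rho> / 2)"
      by (rule holomorphic_on_subset[OF hol]) (use sub[OF w] ball_subset_cball in blast)
    show "continuous_on (cball w (\<rho> / 2)) f"
      by (rule holomorphic_on_imp_continuous_on[OF holomorphic_on_subset[OF hol sub[OF w]]])
    show "0 < \<rho> / 2" using \<open>0 < \<rho>\<close> by simp
    fix x assume "cmod (w - x) = \<rho> / 2"
    then have "x \<in> cball w (\<rho> / 2)" by (simp add: dist_norm)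
    then have "x \<in> ball 0 \<rho>" using sub[OF w] by blast
    then show "cmod (f x) \<le> M" using B by blast
  qed
  show "cmod (deriv f 0) \<le> 2 * M / \<rho>"
    using C[of 0 1] \<open>0 < \<rho>\<close> by (simp add: field_simps)
  have D: "((deriv ^^ i) f has_field_derivative (deriv ^^ Suc i) f w) (at w within ball 0 (\<rho> / 2))"
    if "w \<in> ball 0 (\<rho> / 2)" for i w
  proof -
    have "(deriv ^^ i) f holomorphic_on ball 0 \<rho>"
      by (rule holomorphic_higher_deriv[OF hol]) simp
    then have "((deriv ^^ i) f has_field_derivative (deriv ^^ Suc i) f w) (at w)"
      using holomorphic_derivI[of "(deriv ^^ i) f" "ball 0 \<rho>" w] that \<open>0 < \<rho>\<close> by simp
    then show ?thesis by (rule has_field_derivative_at_within)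
  qed
  assume z: "cmod z < \<rho> / 2"
  show "cmod (f z - f 0) \<le> 2 * M / \<rho> * cmod z"
  proof -
    have "cmod ((deriv ^^ 0) f z - (\<Sum>i\<le>0. (deriv ^^ i) f 0 * (z - 0) ^ i / fact i))
        \<le> 2 * M / \<rho> * cmod (z - 0) ^ Suc 0 / fact 0"
      by (rule complex_Taylor[where S = "ball 0 (\<rho> / 2)"], simp, erule D)
        (use C[of _ 1] z \<open>0 < \<rho>\<close> in \<open>auto simp: field_simps\<close>)
    then show ?thesis by simp
  qed
  show "cmod (f z - f 0 - z * deriv f 0) \<le> 8 * M / \<rho>\<^sup>2 * (cmod z)\<^sup>2"
  proof -
    have "cmod ((deriv ^^ 0) f z - (\<Sum>i\<le>1. (deriv ^^ i) f 0 * (z - 0) ^ i / fact i))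
        \<le> 8 * M / \<rho>\<^sup>2 * cmod (z - 0) ^ Suc 1 / fact 1"
      by (rule complex_Taylor[where S = "ball 0 (\<rho> / 2)"], simp, erule D)
        (use C[of _ 2] z \<open>0 < \<rho>\<close> in \<open>auto simp: field_simps power2_eq_square numeral_2_eq_2\<close>)
    then show ?thesis by (simp add: power2_eq_square algebra_simps)
  qed
qed

text \<open>The scalar estimates are applied to z -> T (f (y + z h)) on the disc of radius R / norm
  h, which restores the homogeneity in h. Bounds independent of T pass to the norm. The third
  estimate has a real step t because it serves difference quotients in a real target.\<close>

lemma gateaux_cauchy_estimates:
  fixes f :: "'a::complex_normed_space \<Rightarrow> 'b::real_normed_vector"
  assumes N: "norming N" and f: "gateaux_holomorphic_on N f (ball y R)" and R: "0 < R"
    and B: "\<forall>u\<in>ball y R. norm (f u) \<le> M"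
  shows "T \<in> N \<Longrightarrow> cmod (deriv (\<lambda>z. T (f (y + z *\<^sub>C h))) 0) \<le> 2 * M / R * norm h"
    and "norm h < R / 2 \<Longrightarrow> norm (f (y + h) - f y) \<le> 2 * M / R * norm h"
    and "T \<in> N \<Longrightarrow> norm (t *\<^sub>R h) < R / 2 \<Longrightarrow>
      cmod (T (f (y + t *\<^sub>R h)) - T (f y) - of_real t * deriv (\<lambda>z. T (f (y + z *\<^sub>C h))) 0)
        \<le> 8 * M / R\<^sup>2 * (norm (t *\<^sub>R h))\<^sup>2"
proof -
  have main: "cmod (deriv (\<lambda>z. T (f (y + z *\<^sub>C h))) 0) \<le> 2 * M / R * norm h \<and>
      (cmod z * norm h < R / 2 \<longrightarrow>
        cmod (T (f (y + z *\<^sub>C h)) - T (f y)) \<le> 2 * M / R * (cmod z * norm h) \<and>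
        cmod (T (f (y + z *\<^sub>C h)) - T (f y) - z * deriv (\<lambda>z. T (f (y + z *\<^sub>C h))) 0)
          \<le> 8 * M / R\<^sup>2 * (cmod z * norm h)\<^sup>2)"
    if T: "T \<in> N" for T h z
  proof (cases "h = 0")
    case True
    then show ?thesis by (simp add: scaleC.zero_right)
  next
    case False
    then have h: "norm h > 0" by simp
    define \<rho> where "\<rho> = R / norm h"
    have \<rho>: "0 < \<rho>" using h R by (simp add: \<rho>_def)
    have mem: "y + z *\<^sub>C h \<in> ball y R" if "cmod z < \<rho>" for z
      using that h by (simp add: dist_norm norm_scaleC \<rho>_def field_simps)
    have hol: "(\<lambda>z. T (f (y + z *\<^sub>C h))) holomorphic_on ball 0 \<rho>"
      by (rule holomorphic_on_subset[OF gateaux_holomorphicD[OF f T]]) (use mem in auto)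
    have bd: "\<forall>z\<in>ball 0 \<rho>. cmod (T (f (y + z *\<^sub>C h))) \<le> M"
    proof
      fix z :: complex assume "z \<in> ball 0 \<rho>"
      then have "norm (f (y + z *\<^sub>C h)) \<le> M" using B mem[of z] by simp
      then show "cmod (T (f (y + z *\<^sub>C h))) \<le> M" using norming_le[OF N T] order_trans by blast
    qed
    note ce = cauchy_estimates[OF hol \<rho> bd]
    have eq: "2 * M / \<rho> = 2 * M / R * norm h" "8 * M / \<rho>\<^sup>2 = 8 * M / R\<^sup>2 * (norm h)\<^sup>2"
        "cmod z < \<rho> / 2 \<longleftrightarrow> cmod z * norm h < R / 2"
      using h R by (simp_all add: \<rho>_def power_divide field_simps)
    show ?thesis
      using ce(1) ce(2)[of z] ce(3)[of z]
      unfolding eq by (simp add: scaleC.zero_left power_mult_distrib mult_ac)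
  qed
  show "T \<in> N \<Longrightarrow> cmod (deriv (\<lambda>z. T (f (y + z *\<^sub>C h))) 0) \<le> 2 * M / R * norm h"
    using main by blast
  show "norm h < R / 2 \<Longrightarrow> norm (f (y + h) - f y) \<le> 2 * M / R * norm h"
    using main[of _ h 1] by (intro norming_bound[OF N]) (simp add: linear_diff[OF norming_linear[OF N]])
  show "T \<in> N \<Longrightarrow> norm (t *\<^sub>R h) < R / 2 \<Longrightarrow>
      cmod (T (f (y + t *\<^sub>R h)) - T (f y) - of_real t * deriv (\<lambda>z. T (f (y + z *\<^sub>C h))) 0)
        \<le> 8 * M / R\<^sup>2 * (norm (t *\<^sub>R h))\<^sup>2"
    using main[of T h "of_real t"] by (simp add: scaleC_of_real)
qed

lemma half_ball_subset:
  fixes x :: "'a::real_normed_vector"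
  assumes "u \<in> ball x (R / 2)"
  shows "ball u (R / 2) \<subseteq> ball x R"
proof
  fix v assume "v \<in> ball u (R / 2)"
  with assms show "v \<in> ball x R" using dist_triangle[of x v u] by simp
qed

text \<open>The first difference in direction k is itself Gateaux holomorphic and of size norm k on
  the half ball. Applying the Cauchy estimate to it gains the factor norm h; this second-order
  smallness makes the derivative additive.\<close>

lemma gateaux_second_difference:
  fixes f :: "'a::complex_normed_space \<Rightarrow> 'b::real_normed_vector"
  assumes N: "norming N" and f: "gateaux_holomorphic_on N f (ball y R)" and R: "0 < R"
    and B: "\<forall>u\<in>ball y R. norm (f u) \<le> M"
    and h: "norm h < R / 4" and k: "norm k < R / 4"
  shows "norm (f (y + h + k) - f (y + h) - f (y + k) + f y) \<le> 16 * M / R\<^sup>2 * norm k * norm h"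
proof -
  define g where "g u = f (u + k) - f u" for u
  have sub: "ball u (R / 2) \<subseteq> ball y R" if "u \<in> ball y (R / 2)" for u
    using that by (rule half_ball_subset)
  have gb: "\<forall>u\<in>ball y (R / 2). norm (g u) \<le> 4 * M / R * norm k"
  proof
    fix u assume u: "u \<in> ball y (R / 2)"
    have "norm (f (u + k) - f u) \<le> 2 * M / (R / 2) * norm k"
      by (rule gateaux_cauchy_estimates(2)[OF N gateaux_holomorphic_on_subset[OF f sub[OF u]]])
        (use R k B sub[OF u] in auto)
    then show "norm (g u) \<le> 4 * M / R * norm k" by (simp add: g_def)
  qed
  have "gateaux_holomorphic_on N g (ball y (R / 2))"
    unfolding g_def
  proof (rule gateaux_holomorphic_on_difference[OF N f])
    fix u assume u: "u \<in> ball y (R / 2)"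
    show "u \<in> ball y R" using u R by auto
    have "u + k \<in> ball u (R / 2)" using k R by (simp add: dist_norm)
    then show "u + k \<in> ball y R" using sub[OF u] by blast
  qed
  from gateaux_cauchy_estimates(2)[OF N this _ gb, of h]
  have "norm (g (y + h) - g y) \<le> 2 * (4 * M / R * norm k) / (R / 2) * norm h"
    using R h by simp
  also have "\<dots> = 16 * M / R\<^sup>2 * norm k * norm h"
    using R by (simp add: power2_eq_square field_simps)
  finally show ?thesis by (simp add: g_def algebra_simps)
qed

text \<open>This is the Graves-Taylor-Zorn theorem, that local boundedness and holomorphy along
  lines give a Frechet derivative, for a real Banach target with a norming set. Every rate of
  convergence is uniform in T, so scalar facts transfer to vectors.\<close>

lemma gateaux_holomorphic_has_derivative:
  fixes f :: "'a::complex_normed_space \<Rightarrow> 'b::banach"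
  assumes N: "norming N" and f: "gateaux_holomorphic_on N f (ball x R)" and R: "0 < R"
    and B: "\<forall>u\<in>ball x R. norm (f u) \<le> M"
  obtains D where "(f has_derivative D) (at x)" "\<And>h. norm (D h) \<le> 2 * M / R * norm h"
    "\<And>T h. T \<in> N \<Longrightarrow> T (D h) = deriv (\<lambda>z. T (f (x + z *\<^sub>C h))) 0"
proof -
  note est = gateaux_cauchy_estimates[OF N f R B]
  define d where "d T h = deriv (\<lambda>z. T (f (x + z *\<^sub>C h))) 0" for T h
  \<comment> \<open>Difference quotients with the real steps 1 / (n + 1).\<close>
  define Q where "Q n h = real (Suc n) *\<^sub>R (f (x + (1 / real (Suc n)) *\<^sub>R h) - f x)" for n h
  have small: "\<exists>n0. \<forall>n\<ge>n0. norm ((1 / real (Suc n)) *\<^sub>R h) < r" if "0 < r" for h :: 'a and r :: real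
  proof -
    have "(\<lambda>n. (1 / real (Suc n)) *\<^sub>R h) \<longlonglongrightarrow> 0 *\<^sub>R h"
      by (intro tendsto_intros LIMSEQ_Suc[OF lim_1_over_n])
    then show ?thesis using LIMSEQ_D[of "\<lambda>n. (1 / real (Suc n)) *\<^sub>R h" 0 r] that by (simp del: norm_scaleR)
  qed
  have TQ: "cmod (T (Q n h) - d T h) \<le> 8 * M / R\<^sup>2 * (norm h)\<^sup>2 / real (Suc n)"
    if T: "T \<in> N" and n: "norm ((1 / real (Suc n)) *\<^sub>R h) < R / 2" for T n h
  proof -
    let ?s = "real (Suc n)"
    have "T (Q n h) - d T h = of_real ?s * (T (f (x + (1 / ?s) *\<^sub>R h)) - T (f x) - of_real (1 / ?s) * d T h)"
      by (simp add: Q_def linear_scale[OF norming_linear[OF N T]] linear_diff[OF norming_linear[OF N T]]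
          scaleR_conv_of_real field_simps del: of_nat_Suc)
    then have "cmod (T (Q n h) - d T h) =
        ?s * cmod (T (f (x + (1 / ?s) *\<^sub>R h)) - T (f x) - of_real (1 / ?s) * d T h)"
      by (simp add: norm_mult del: of_nat_Suc)
    also have "\<dots> \<le> ?s * (8 * M / R\<^sup>2 * (norm ((1 / ?s) *\<^sub>R h))\<^sup>2)"
      unfolding d_def by (intro mult_left_mono est(3)[OF T n]) simp
    also have "\<dots> = 8 * M / R\<^sup>2 * (norm h)\<^sup>2 / ?s"
      by (simp add: power2_eq_square field_simps del: of_nat_Suc)
    finally show ?thesis .
  qed
  have lim0: "(\<lambda>n. c / real (Suc n)) \<longlonglongrightarrow> 0" for c :: real
    using tendsto_mult_right_zero[OF LIMSEQ_Suc[OF lim_1_over_n[where 'a = real]], of c] by simp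
  \<comment> \<open>\<open>TQ\<close> bounds the distance of T (Q n h) to its limit independently of
    T; this gives the Cauchy property in norm before a limit vector is known.\<close>
  have "Cauchy (\<lambda>n. Q n h)" for h
  proof (rule metric_CauchyI)
    fix e :: real assume "0 < e"
    obtain n0 where n0: "\<And>n. n \<ge> n0 \<Longrightarrow> norm ((1 / real (Suc n)) *\<^sub>R h) < R / 2"
      using small[of "R / 2" h] R by auto
    obtain n1 where n1: "\<And>n. n \<ge> n1 \<Longrightarrow> 8 * M / R\<^sup>2 * (norm h)\<^sup>2 / real (Suc n) < e / 3"
      using order_tendstoD(2)[OF lim0, of "e / 3" "8 * M / R\<^sup>2 * (norm h)\<^sup>2"] \<open>0 < e\<close>
      by (auto simp: eventually_sequentially)
    have "dist (Q m h) (Q n h) < e" if m: "m \<ge> max n0 n1" and n: "n \<ge> max n0 n1" for m n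
    proof -
      have "norm (Q m h - Q n h) \<le> e / 3 + e / 3"
      proof (rule norming_bound[OF N])
        fix T assume T: "T \<in> N"
        have "cmod (T (Q m h - Q n h)) = cmod ((T (Q m h) - d T h) - (T (Q n h) - d T h))"
          by (simp add: linear_diff[OF norming_linear[OF N T]])
        also have "\<dots> \<le> cmod (T (Q m h) - d T h) + cmod (T (Q n h) - d T h)"
          by (rule norm_triangle_ineq4)
        also have "\<dots> \<le> e / 3 + e / 3"
          using TQ[OF T n0[of m]] TQ[OF T n0[of n]] n1[of m] n1[of n] m n by (intro add_mono) auto
        finally show "cmod (T (Q m h - Q n h)) \<le> e / 3 + e / 3" .
      qed
      then show ?thesis using \<open>0 < e\<close> by (simp add: dist_norm)
    qed
    then show "\<exists>K. \<forall>m\<ge>K. \<forall>n\<ge>K. dist (Q m h) (Q n h) < e" by blast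
  qed
  then have "\<forall>h. \<exists>L. (\<lambda>n. Q n h) \<longlonglongrightarrow> L"
    using Cauchy_convergent convergent_def by blast
  then obtain D where D: "\<And>h. (\<lambda>n. Q n h) \<longlonglongrightarrow> D h" by metis
  have TD: "T (D h) = d T h" if T: "T \<in> N" for T h
  proof (rule LIMSEQ_unique)
    show "(\<lambda>n. T (Q n h)) \<longlonglongrightarrow> T (D h)"
      by (rule bounded_linear.tendsto[OF norming_bounded_linear[OF N T] D])
    obtain n0 where n0: "\<And>n. n \<ge> n0 \<Longrightarrow> norm ((1 / real (Suc n)) *\<^sub>R h) < R / 2"
      using small[of "R / 2" h] R by auto
    have "(\<lambda>n. T (Q n h) - d T h) \<longlonglongrightarrow> 0"
      by (rule Lim_null_comparison[OF _ lim0[of "8 * M / R\<^sup>2 * (norm h)\<^sup>2"]])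
        (use TQ[OF T n0] in \<open>auto simp: eventually_sequentially\<close>)
    then show "(\<lambda>n. T (Q n h)) \<longlonglongrightarrow> d T h" by (simp add: LIM_zero_iff)
  qed
  have Db: "norm (D h) \<le> 2 * M / R * norm h" for h
    by (rule norming_bound[OF N]) (use est(1) in \<open>simp add: TD d_def\<close>)
  \<comment> \<open>The second difference is of order 1 / (n + 1)^2, so it still tends to 0 after
    multiplication by n + 1.\<close>
  have add: "D (h + k) = D h + D k" for h k
  proof -
    obtain n0 where n0: "\<And>n. n \<ge> n0 \<Longrightarrow> norm ((1 / real (Suc n)) *\<^sub>R h) < R / 4"
      using small[of "R / 4" h] R by auto
    obtain n1 where n1: "\<And>n. n \<ge> n1 \<Longrightarrow> norm ((1 / real (Suc n)) *\<^sub>R k) < R / 4"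
      using small[of "R / 4" k] R by auto
    have "norm (Q n (h + k) - Q n h - Q n k) \<le> 16 * M / R\<^sup>2 * norm k * norm h / real (Suc n)"
      if n: "n \<ge> max n0 n1" for n
    proof -
      let ?s = "real (Suc n)" and ?t = "1 / real (Suc n)"
      have "Q n (h + k) - Q n h - Q n k = ?s *\<^sub>R (f (x + ?t *\<^sub>R h + ?t *\<^sub>R k) - f (x + ?t *\<^sub>R h)
          - f (x + ?t *\<^sub>R k) + f x)"
        by (simp add: Q_def algebra_simps del: of_nat_Suc)
      then have "norm (Q n (h + k) - Q n h - Q n k) = ?s * norm (f (x + ?t *\<^sub>R h + ?t *\<^sub>R k)
          - f (x + ?t *\<^sub>R h) - f (x + ?t *\<^sub>R k) + f x)"
        by (simp del: of_nat_Suc)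
      also have "\<dots> \<le> ?s * (16 * M / R\<^sup>2 * norm (?t *\<^sub>R k) * norm (?t *\<^sub>R h))"
        using n by (intro mult_left_mono gateaux_second_difference[OF N f R B] n0 n1) auto
      also have "\<dots> = 16 * M / R\<^sup>2 * norm k * norm h / ?s"
        by (simp add: field_simps del: of_nat_Suc)
      finally show ?thesis .
    qed
    then have "(\<lambda>n. Q n (h + k) - Q n h - Q n k) \<longlonglongrightarrow> 0"
      by (intro Lim_null_comparison[OF _ lim0[of "16 * M / R\<^sup>2 * norm k * norm h"]]
          eventually_sequentiallyI[of "max n0 n1"])
    moreover have "(\<lambda>n. Q n (h + k) - Q n h - Q n k) \<longlonglongrightarrow> D (h + k) - D h - D k"
      by (intro tendsto_intros D)
    ultimately have "D (h + k) - D h - D k = 0" by (rule LIMSEQ_unique[symmetric])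
    then show ?thesis by (simp add: algebra_simps)
  qed
  \<comment> \<open>Replacing h by r h reparametrizes the same line, so the scalar chain rule under
    each T suffices.\<close>
  have scale: "D (r *\<^sub>R h) = r *\<^sub>R D h" for r h
  proof -
    have "norm (D (r *\<^sub>R h) - r *\<^sub>R D h) \<le> 0"
    proof (rule norming_bound[OF N])
      fix T assume T: "T \<in> N"
      let ?\<phi> = "\<lambda>z. T (f (x + z *\<^sub>C h))"
      have "?\<phi> holomorphic_on {z. x + z *\<^sub>C h \<in> ball x R}"
        by (rule gateaux_holomorphicD[OF f T])
      moreover have "open {z. x + z *\<^sub>C h \<in> ball x R}" by (rule open_complex_line) simp
      ultimately have "?\<phi> field_differentiable at 0"
        by (rule holomorphic_on_imp_differentiable_at) (use R in \<open>simp add: scaleC.zero_left\<close>)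
      then have "deriv (\<lambda>z. ?\<phi> (of_real r * z)) 0 = of_real r * deriv ?\<phi> 0"
        using deriv_compose_linear[of ?\<phi> "of_real r" 0] by simp
      moreover have "(\<lambda>z. ?\<phi> (of_real r * z)) = (\<lambda>z. T (f (x + z *\<^sub>C (r *\<^sub>R h))))"
        by (simp add: scaleC_scaleC mult.commute flip: scaleC_of_real)
      ultimately have "d T (r *\<^sub>R h) = of_real r * d T h" by (simp add: d_def)
      then show "cmod (T (D (r *\<^sub>R h) - r *\<^sub>R D h)) \<le> 0"
        by (simp add: linear_diff[OF norming_linear[OF N T]] linear_scale[OF norming_linear[OF N T]]
            TD[OF T] scaleR_conv_of_real)
    qed
    then show ?thesis by simp
  qed
  have bl: "bounded_linear D"
    by (rule bounded_linear_intro[OF add scale, where K = "2 * M / R"]) (use Db in \<open>simp add: mult.commute\<close>)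
  have quad: "norm (f (x + h) - f x - D h) \<le> 8 * M / R\<^sup>2 * (norm h)\<^sup>2" if h: "norm h < R / 2" for h
    by (rule norming_bound[OF N])
      (use est(3)[of _ 1 h] h in \<open>simp add: linear_diff[OF norming_linear[OF N]] TD d_def\<close>)
  have "(f has_derivative D) (at x)"
  proof (rule has_derivativeI_sandwich[where e = "R / 2"])
    fix u assume "u \<noteq> x" "dist u x < R / 2"
    then show "norm (f u - f x - D (u - x)) / norm (u - x) \<le> 8 * M / R\<^sup>2 * norm (u - x)"
      using quad[of "u - x"] by (simp add: dist_norm pos_divide_le_eq power2_eq_square mult.assoc)
  next
    have "((\<lambda>u. 8 * M / R\<^sup>2 * norm (u - x)) \<longlongrightarrow> 8 * M / R\<^sup>2 * norm (x - x)) (at x)"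
      by (intro tendsto_intros)
    then show "((\<lambda>u. 8 * M / R\<^sup>2 * norm (u - x)) \<longlongrightarrow> 0) (at x)" by simp
  qed (use R bl in auto)
  then show ?thesis using Db TD by (intro that) (auto simp: d_def)
qed

lemma fderiv_eqI:
  assumes "(f has_derivative D) (at x)"
  shows "blinfun_apply (fderiv f x) = D"
proof -
  have "D = frechet_derivative f (at x)" by (rule frechet_derivative_at[OF assms])
  then show ?thesis
    using has_derivative_bounded_linear[OF assms] by (simp add: fderiv_def bounded_linear_Blinfun_apply)
qed

section \<open>Passing from a map to its operator-valued derivative\<close>

definition evaluations :: "('b::real_normed_vector \<Rightarrow> complex) set \<Rightarrow> ('a::real_normed_vector \<Rightarrow>\<^sub>L 'b \<Rightarrow> complex) set"
  where "evaluations N = {\<lambda>A. T (blinfun_apply A v) | T v. T \<in> N \<and> norm v \<le> 1}"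

lemma evaluationsI: "T \<in> N \<Longrightarrow> norm v \<le> 1 \<Longrightarrow> (\<lambda>A. T (blinfun_apply A v)) \<in> evaluations N"
  by (auto simp: evaluations_def)

lemma norming_evaluations:
  assumes N: "norming (N :: ('b::real_normed_vector \<Rightarrow> complex) set)"
  shows "norming (evaluations N :: (('a::real_normed_vector \<Rightarrow>\<^sub>L 'b) \<Rightarrow> complex) set)"
  unfolding norming_def
proof (intro conjI ballI allI impI)
  fix E :: "('a \<Rightarrow>\<^sub>L 'b) \<Rightarrow> complex" assume "E \<in> evaluations N"
  then obtain T v where T: "T \<in> N" and v: "norm v \<le> 1" and E: "E = (\<lambda>A. T (blinfun_apply A v))"
    by (auto simp: evaluations_def)
  show "linear E"
    by (rule linearI) (simp_all add: E blinfun.add_left blinfun.scaleR_left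
        linear_add[OF norming_linear[OF N T]] linear_scale[OF norming_linear[OF N T]])
  fix A :: "'a \<Rightarrow>\<^sub>L 'b"
  have "cmod (E A) \<le> norm (A v)" by (simp add: E norming_le[OF N T])
  also have "\<dots> \<le> norm A * norm v" by (rule norm_blinfun)
  also have "\<dots> \<le> norm A" using v by (simp add: mult_left_le)
  finally show "cmod (E A) \<le> norm A" .
next
  fix A :: "'a \<Rightarrow>\<^sub>L 'b" and B assume *: "\<forall>E\<in>evaluations N. cmod (E A) \<le> B"
  have 1: "norm (A v) \<le> B" if "norm v \<le> 1" for v
    by (rule norming_bound[OF N]) (rule bspec[OF *, OF evaluationsI[OF _ that]])
  have B: "0 \<le> B" using 1[of 0] by simp
  show "norm A \<le> B"
  proof (rule norm_blinfun_bound[OF B])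
    fix x
    show "norm (A x) \<le> B * norm x"
    proof (cases "x = 0")
      case False
      then show ?thesis
        using 1[of "(1 / norm x) *\<^sub>R x"] by (simp add: blinfun.scaleR_right field_simps)
    qed simp
  qed
qed

text \<open>The first part makes the theory iterable. For fixed v, the function z -> T (f'(y + z w)
  v) is a locally uniform limit of difference quotients in direction v, each holomorphic in z; the
  Cauchy estimates on half balls give the local bound. The second part identifies the derivative in
  the direction of the line with an ordinary complex derivative.\<close>

lemma
  fixes f :: "'a::complex_normed_space \<Rightarrow> 'b::banach"
  assumes N: "norming N" and S: "open S" and f: "weakly_holomorphic_on N f S"
  shows weakly_holomorphic_on_fderiv: "weakly_holomorphic_on (evaluations N) (fderiv f) S"
    and fderiv_along_line: "T \<in> N \<Longrightarrow> y + z *\<^sub>C w \<in> S \<Longrightarrow>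
      T (fderiv f (y + z *\<^sub>C w) w) = deriv (\<lambda>z. T (f (y + z *\<^sub>C w))) z"
proof -
  have gf: "gateaux_holomorphic_on N f S" using f by (simp add: weakly_holomorphic_on_def)
  have ex: "\<exists>R>0. ball x R \<subseteq> S \<and> (\<exists>M. \<forall>u\<in>ball x R. norm (f u) \<le> M)" if "x \<in> S" for x
  proof -
    obtain R1 where R1: "R1 > 0" "ball x R1 \<subseteq> S" using S \<open>x \<in> S\<close> openE by blast
    obtain R2 M where R2: "R2 > 0" "\<forall>u\<in>ball x R2. norm (f u) \<le> M"
      using f \<open>x \<in> S\<close> by (auto simp: weakly_holomorphic_on_def)
    show ?thesis
      by (rule exI[of _ "min R1 R2"]) (use R1 R2 in \<open>auto intro!: exI[of _ M]\<close>)
  qed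
  \<comment> \<open>The centre and the radius are left free because the estimates are also needed on
    half balls about nearby points.\<close>
  have D: "norm (fderiv f u h) \<le> 2 * M / R * norm h \<and>
      (T \<in> N \<longrightarrow> T (fderiv f u h) = deriv (\<lambda>z. T (f (u + z *\<^sub>C h))) 0)"
    if R: "R > 0" "ball u R \<subseteq> S" and B: "\<forall>v\<in>ball u R. norm (f v) \<le> M" for u R M h T
  proof -
    obtain D where "(f has_derivative D) (at u)" "\<And>h. norm (D h) \<le> 2 * M / R * norm h"
      "\<And>T h. T \<in> N \<Longrightarrow> T (D h) = deriv (\<lambda>z. T (f (u + z *\<^sub>C h))) 0"
      by (rule gateaux_holomorphic_has_derivative[OF N gateaux_holomorphic_on_subset[OF gf R(2)] R(1) B])
        blast
    then show ?thesis by (simp add: fderiv_eqI)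
  qed
  show line: "T (fderiv f (y + z *\<^sub>C w) w) = deriv (\<lambda>z. T (f (y + z *\<^sub>C w))) z"
    if T: "T \<in> N" and z: "y + z *\<^sub>C w \<in> S" for T y z w
  proof -
    obtain R M where R: "R > 0" "ball (y + z *\<^sub>C w) R \<subseteq> S" "\<forall>v\<in>ball (y + z *\<^sub>C w) R. norm (f v) \<le> M"
      using ex[OF z] by blast
    then have "T (fderiv f (y + z *\<^sub>C w) w) = deriv (\<lambda>s. T (f (y + z *\<^sub>C w + s *\<^sub>C w))) 0"
      using D[OF R(1,2), of M w T] T by blast
    also have "(\<lambda>s. T (f (y + z *\<^sub>C w + s *\<^sub>C w))) = (\<lambda>s. T (f (y + s *\<^sub>C w))) \<circ> (+) z"
      by (simp add: o_def scaleC_add_left add.assoc)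
    also have "deriv \<dots> 0 = deriv (\<lambda>s. T (f (y + s *\<^sub>C w))) z"
      by (rule deriv_shift_0[symmetric])
    finally show ?thesis .
  qed
  show "weakly_holomorphic_on (evaluations N) (fderiv f) S"
    unfolding weakly_holomorphic_on_def
  proof (intro conjI ballI)
    fix x assume "x \<in> S"
    then obtain R M where R: "R > 0" "ball x R \<subseteq> S" and M: "\<forall>u\<in>ball x R. norm (f u) \<le> M"
      using ex by blast
    have "norm (fderiv f u) \<le> 2 * M / (R / 2)" if u: "u \<in> ball x (R / 2)" for u
    proof -
      have sub: "ball u (R / 2) \<subseteq> ball x R" using u by (rule half_ball_subset)
      have "norm (f x) \<le> M" using M R by simp
      then have "0 \<le> M" using norm_ge_zero order_trans by blast
      then show ?thesis
        using D[of "R / 2" u M _] sub R M by (intro norm_blinfun_bound) (auto simp: subset_iff)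
    qed
    then show "\<exists>r>0. \<exists>K. \<forall>u\<in>ball x r. norm (fderiv f u) \<le> K"
      using R by (intro exI[of _ "R / 2"] conjI exI[of _ "2 * M / (R / 2)"]) auto
  next
    show "gateaux_holomorphic_on (evaluations N) (fderiv f) S"
      unfolding gateaux_holomorphic_on_def
    proof (intro ballI allI)
      fix E :: "('a \<Rightarrow>\<^sub>L 'b) \<Rightarrow> complex" and y w :: 'a
      assume "E \<in> evaluations N"
      then obtain T v where T: "T \<in> N" and v: "norm v \<le> 1" and E: "E = (\<lambda>A. T (blinfun_apply A v))"
        by (auto simp: evaluations_def)
      let ?U = "{z. y + z *\<^sub>C w \<in> S}" and ?g = "\<lambda>z. T (fderiv f (y + z *\<^sub>C w) v)"
      have "?g field_differentiable at z0" if "z0 \<in> ?U" for z0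
      proof -
        define x0 where "x0 = y + z0 *\<^sub>C w"
        obtain R M where R: "R > 0" "ball x0 R \<subseteq> S" and M: "\<forall>u\<in>ball x0 R. norm (f u) \<le> M"
          using ex \<open>z0 \<in> ?U\<close> x0_def by blast
        have "open {z. y + z *\<^sub>C w \<in> ball x0 (R / 2)}" by (rule open_complex_line) simp
        moreover have "z0 \<in> {z. y + z *\<^sub>C w \<in> ball x0 (R / 2)}" using R by (simp add: x0_def)
        ultimately obtain \<delta> where \<delta>: "\<delta> > 0" "ball z0 \<delta> \<subseteq> {z. y + z *\<^sub>C w \<in> ball x0 (R / 2)}"
          using openE by blast
        \<comment> \<open>Steps of at most R / 8 stay below R / 4, the range of the Cauchy estimates
          on balls of radius R / 2, for all z near z0 at once.\<close>
        define t where "t n = R / 8 * (1 / real (Suc n))" for n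
        have t: "0 < t n" "t n \<le> R / 8" for n
          using R by (simp_all add: t_def field_simps)
        define q where "q n z = (T (f (y + z *\<^sub>C w + t n *\<^sub>R v)) - T (f (y + z *\<^sub>C w))) / of_real (t n)" for n z
        have tv: "norm (t n *\<^sub>R v) < R / 2 / 2" for n
        proof -
          have "norm (t n *\<^sub>R v) \<le> t n" using v t[of n] by (simp add: mult_left_le)
          also have "\<dots> < R / 2 / 2" using t[of n] R by simp
          finally show ?thesis .
        qed
        have sub: "ball u (R / 2) \<subseteq> ball x0 R" if "u \<in> ball x0 (R / 2)" for u
          using that by (rule half_ball_subset)
        have mem: "y + z *\<^sub>C w \<in> ball x0 (R / 2)" "y + z *\<^sub>C w \<in> S" "y + t n *\<^sub>R v + z *\<^sub>C w \<in> S"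
          if z: "z \<in> ball z0 \<delta>" for z n
        proof -
          show 1: "y + z *\<^sub>C w \<in> ball x0 (R / 2)" using z \<delta> by blast
          show "y + z *\<^sub>C w \<in> S" using 1 R by auto
          have "y + t n *\<^sub>R v + z *\<^sub>C w \<in> ball (y + z *\<^sub>C w) (R / 2)"
            using tv[of n] R by (simp add: dist_norm)
          then show "y + t n *\<^sub>R v + z *\<^sub>C w \<in> S" using sub[OF 1] R by blast
        qed
        have q: "cmod (q n z - ?g z) \<le> 8 * M / (R / 2)\<^sup>2 * t n" if z: "z \<in> ball z0 \<delta>" for n z
        proof -
          let ?u = "y + z *\<^sub>C w"
          have Mu: "\<forall>v\<in>ball ?u (R / 2). norm (f v) \<le> M"
            using M sub[OF mem(1)[OF z]] by blast
          have Su: "ball ?u (R / 2) \<subseteq> S" using sub[OF mem(1)[OF z]] R by blast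
          have "0 \<le> M" using bspec[OF Mu, of ?u] R norm_ge_zero[of "f ?u"] by (simp del: norm_ge_zero)
          have "T (fderiv f ?u v) = deriv (\<lambda>s. T (f (?u + s *\<^sub>C v))) 0"
            using D[of "R / 2" ?u M v T] R Mu Su T by simp
          then have "cmod (T (f (?u + t n *\<^sub>R v)) - T (f ?u) - of_real (t n) * ?g z)
              \<le> 8 * M / (R / 2)\<^sup>2 * (norm (t n *\<^sub>R v))\<^sup>2"
            using gateaux_cauchy_estimates(3)[OF N gateaux_holomorphic_on_subset[OF gf Su] _ Mu T tv[of n]] R
            by simp
          also have "\<dots> \<le> 8 * M / (R / 2)\<^sup>2 * (t n)\<^sup>2"
            using v t[of n] \<open>0 \<le> M\<close> by (intro mult_left_mono power_mono) (auto simp: mult_left_le)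
          finally have "cmod (T (f (?u + t n *\<^sub>R v)) - T (f ?u) - of_real (t n) * ?g z) / t n
              \<le> 8 * M / (R / 2)\<^sup>2 * t n"
            using t[of n] by (simp add: power2_eq_square field_simps)
          moreover have "q n z - ?g z = (T (f (?u + t n *\<^sub>R v)) - T (f ?u) - of_real (t n) * ?g z) / of_real (t n)"
            using t(1)[of n] by (simp add: q_def diff_divide_distrib)
          ultimately show ?thesis using t(1)[of n] by (simp add: norm_divide)
        qed
        have qhol: "q n holomorphic_on ball z0 \<delta>" for n
        proof -
          have "(\<lambda>z. (T (f ((y + t n *\<^sub>R v) + z *\<^sub>C w)) - T (f (y + z *\<^sub>C w))) / of_real (t n)) holomorphic_on ball z0 \<delta>"
            using mem t(1)[of n]
            by (intro holomorphic_intros gateaux_holomorphicD[OF gf T, THEN holomorphic_on_subset]) auto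
          then show ?thesis by (simp add: q_def[abs_def] add_ac)
        qed
        \<comment> \<open>The error is at most a constant times t n, with a constant independent of
          z; Weierstrass' theorem then yields holomorphy.\<close>
        have ul: "uniform_limit (ball z0 \<delta>) q ?g sequentially"
        proof (rule uniform_limitI)
          fix e :: real assume "0 < e"
          have "(\<lambda>n. 8 * M / (R / 2)\<^sup>2 * t n) \<longlonglongrightarrow> 8 * M / (R / 2)\<^sup>2 * (R / 8 * 0)"
            unfolding t_def by (intro tendsto_intros LIMSEQ_Suc[OF lim_1_over_n])
          then have "(\<lambda>n. 8 * M / (R / 2)\<^sup>2 * t n) \<longlonglongrightarrow> 0" by simp
          then have "\<forall>\<^sub>F n in sequentially. 8 * M / (R / 2)\<^sup>2 * t n < e"
            using order_tendstoD(2) \<open>0 < e\<close> by blast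
          then show "\<forall>\<^sub>F n in sequentially. \<forall>z\<in>ball z0 \<delta>. dist (q n z) (?g z) < e"
          proof eventually_elim
            case (elim n)
            show ?case
            proof
              fix z assume "z \<in> ball z0 \<delta>"
              then show "dist (q n z) (?g z) < e" using le_less_trans[OF q elim] by (simp add: dist_norm)
            qed
          qed
        qed
        have "?g holomorphic_on ball z0 \<delta>"
        proof (rule holomorphic_uniform_sequence[OF _ qhol])
          fix z assume "z \<in> ball z0 \<delta>"
          then obtain r where "0 < r" "cball z r \<subseteq> ball z0 \<delta>" using open_contains_cball by blast
          then show "\<exists>r>0. cball z r \<subseteq> ball z0 \<delta> \<and> uniform_limit (cball z r) q ?g sequentially"
            using uniform_limit_on_subset[OF ul] by blast
        qed simp
        then show ?thesis by (rule holomorphic_on_imp_differentiable_at) (use \<delta> in auto)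
      qed
      then have "?g holomorphic_on ?U"
        by (auto simp: holomorphic_on_def intro: field_differentiable_at_within)
      then show "(\<lambda>z. E (fderiv f (y + z *\<^sub>C w))) holomorphic_on ?U" by (simp add: E)
    qed
  qed
qed

section \<open>Frechet holomorphic maps tested by complex functionals\<close>

definition unit_functionals :: "('a::complex_normed_space \<Rightarrow> complex) set"
  where "unit_functionals = {blinfun_apply T | T. norm T \<le> 1 \<and> (\<forall>c v. blinfun_apply T (c *\<^sub>C v) = c * blinfun_apply T v)}"

lemma norming_unit_functionals: "norming (unit_functionals :: ('a::complex_normed_space \<Rightarrow> complex) set)"
  unfolding norming_def
proof (intro conjI ballI allI impI)
  fix T :: "'a \<Rightarrow> complex" assume "T \<in> unit_functionals"
  then obtain T' where T': "T = blinfun_apply T'" "norm T' \<le> 1" by (auto simp: unit_functionals_def)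
  show "linear T" unfolding T' by (rule bounded_linear.linear[OF blinfun.bounded_linear_right])
  fix y :: 'a
  have "cmod (T y) \<le> norm T' * norm y" by (simp add: T' norm_blinfun)
  also have "\<dots> \<le> 1 * norm y" by (rule mult_right_mono) (simp_all add: T')
  finally show "cmod (T y) \<le> norm y" by simp
next
  fix y :: 'a and B
  assume *: "\<forall>T\<in>unit_functionals. cmod (T y) \<le> B"
  show "norm y \<le> B"
  proof (cases "y = 0")
    case True
    have "blinfun_apply (0 :: 'a \<Rightarrow>\<^sub>L complex) \<in> unit_functionals"
      unfolding unit_functionals_def by (rule CollectI, rule exI[of _ 0]) simp
    then have "0 \<le> B" using * by force
    then show ?thesis using True by simp
  next
    case False
    then obtain T where "T \<in> support_functionals y" using support_functionals_nonempty by blast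
    then have "blinfun_apply T \<in> unit_functionals" "cmod (T y) = norm y"
      by (auto simp: support_functionals_def unit_functionals_def)
    then show ?thesis using * by force
  qed
qed

text \<open>Complex linearity of D and T turns the real derivative h -> T (D (h v)) of the composite
  into multiplication by T (D v).\<close>

lemma holomorphic_along_line:
  assumes S: "open S" and f: "frechet_holomorphic_on f S" and T: "T \<in> unit_functionals"
  shows "(\<lambda>z. T (f (y + z *\<^sub>C v))) holomorphic_on {z. y + z *\<^sub>C v \<in> S}"
  unfolding holomorphic_on_def
proof
  fix z assume "z \<in> {z. y + z *\<^sub>C v \<in> S}"
  then obtain D where D: "(f has_derivative D) (at (y + z *\<^sub>C v))" and DC: "\<And>c v. D (c *\<^sub>C v) = c *\<^sub>C D v"
    using f by (auto simp: frechet_holomorphic_on_def)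
  obtain T' where T': "T = blinfun_apply T'" and TC: "\<And>c v. T (c *\<^sub>C v) = c * T v"
    using T by (auto simp: unit_functionals_def)
  have "((\<lambda>z. y + z *\<^sub>C v) has_derivative (\<lambda>h. h *\<^sub>C v)) (at z)"
    by (auto intro!: derivative_eq_intros scaleC.FDERIV simp: scaleC.zero_right)
  then have "((\<lambda>z. f (y + z *\<^sub>C v)) has_derivative (\<lambda>h. D (h *\<^sub>C v))) (at z)"
    by (rule has_derivative_compose) (rule D)
  then have "((\<lambda>z. T (f (y + z *\<^sub>C v))) has_derivative (\<lambda>h. T (D (h *\<^sub>C v)))) (at z)"
    unfolding T' by (rule bounded_linear.has_derivative[OF blinfun.bounded_linear_right])
  moreover have "(\<lambda>h. T (D (h *\<^sub>C v))) = (*) (T (D v))"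
    by (auto simp: DC TC)
  ultimately have "((\<lambda>z. T (f (y + z *\<^sub>C v))) has_field_derivative T (D v)) (at z)"
    by (simp add: has_field_derivative_def)
  then show "(\<lambda>z. T (f (y + z *\<^sub>C v))) field_differentiable at z within {z. y + z *\<^sub>C v \<in> S}"
    using field_differentiable_at_within field_differentiable_def by blast
qed

lemma frechet_imp_weakly_holomorphic_on:
  assumes S: "open S" and f: "frechet_holomorphic_on f S"
  shows "weakly_holomorphic_on unit_functionals f S"
  unfolding weakly_holomorphic_on_def gateaux_holomorphic_on_def
proof (intro conjI ballI allI holomorphic_along_line[OF S f])
  fix x assume "x \<in> S"
  then have "isCont f x"
    using f by (auto simp: frechet_holomorphic_on_def dest!: bspec[OF _ \<open>x \<in> S\<close>] intro: has_derivative_continuous)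
  then obtain r where r: "r > 0" "\<And>u. dist u x < r \<Longrightarrow> dist (f u) (f x) < 1"
    by (auto simp: continuous_at_eps_delta dest: spec[of _ 1])
  have "norm (f u) \<le> norm (f x) + 1" if "u \<in> ball x r" for u
    using r(2)[of u] that norm_triangle_ineq2[of "f u" "f x"] by (simp add: dist_norm norm_minus_commute)
  with r(1) show "\<exists>R>0. \<exists>M. \<forall>y\<in>ball x R. norm (f y) \<le> M" by blast
qed

section \<open>Coefficients of radial mappings\<close>

text \<open>Each derivative lives in a new operator type, so the iteration is not an induction on k;
  this is one step, applied four times. The hypothesis covers the whole disc so that it can be
  differentiated.\<close>

lemma iterated_fderiv_along_line:
  fixes f :: "'a::complex_normed_space \<Rightarrow> 'b::banach"
  assumes N: "norming N" and f: "weakly_holomorphic_on N f (ball 0 1)" and T: "T \<in> N" and u: "norm u \<le> 1"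
    and eq: "\<forall>z\<in>ball 0 1. T (f (z *\<^sub>C u)) = (deriv ^^ k) c z"
  shows "\<forall>z\<in>ball 0 1. T (fderiv f (z *\<^sub>C u) u) = (deriv ^^ Suc k) c z"
proof
  fix z :: complex assume z: "z \<in> ball 0 1"
  have "cmod z * norm u \<le> cmod z" using u by (simp add: mult_left_le)
  with z have "z *\<^sub>C u \<in> ball 0 1" by (simp add: norm_scaleC)
  then have "T (fderiv f (z *\<^sub>C u) u) = deriv (\<lambda>z. T (f (z *\<^sub>C u))) z"
    using fderiv_along_line[OF N open_ball f T, of 0 z u] by simp
  also have "\<dots> = deriv ((deriv ^^ k) c) z"
    by (rule deriv_cong_ev) (use eq eventually_nhds_in_open[OF open_ball z] in \<open>auto elim: eventually_mono\<close>)
  finally show "T (fderiv f (z *\<^sub>C u) u) = (deriv ^^ Suc k) c z" by simp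
qed

lemma coefficients_along_line:
  fixes F :: "'a::complex_banach \<Rightarrow> 'a"
  assumes F: "frechet_holomorphic_on F (ball 0 1)" and T: "blinfun_apply T \<in> unit_functionals"
    and u: "norm u \<le> 1"
  defines "P \<equiv> fps_expansion (\<lambda>z. T (F (z *\<^sub>C u))) 0"
  shows "A2 F T u = fps_nth P 2" "A3 F T u = fps_nth P 3" "A4 F T u = fps_nth P 4"
proof -
  let ?c = "\<lambda>z. T (F (z *\<^sub>C u))"
  note N0 = norming_unit_functionals
  note W0 = frechet_imp_weakly_holomorphic_on[OF open_ball F]
  note N1 = norming_evaluations[OF N0] and W1 = weakly_holomorphic_on_fderiv[OF N0 open_ball W0]
  note N2 = norming_evaluations[OF N1] and W2 = weakly_holomorphic_on_fderiv[OF N1 open_ball W1]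
  note N3 = norming_evaluations[OF N2] and W3 = weakly_holomorphic_on_fderiv[OF N2 open_ball W2]
  note T1 = evaluationsI[OF T u] note T2 = evaluationsI[OF T1 u] note T3 = evaluationsI[OF T2 u]
  have 0: "\<forall>z\<in>ball 0 1. T (F (z *\<^sub>C u)) = (deriv ^^ 0) ?c z" by simp
  note 1 = iterated_fderiv_along_line[OF N0 W0 T u 0]
  note 2 = iterated_fderiv_along_line[OF N1 W1 T1 u 1]
  note 3 = iterated_fderiv_along_line[OF N2 W2 T2 u 2]
  note 4 = iterated_fderiv_along_line[OF N3 W3 T3 u 3]
  show "A2 F T u = fps_nth P 2"
    using bspec[OF 2, of 0] by (simp add: A2_def P_def fps_expansion_def scaleC.zero_left eval_nat_numeral)
  show "A3 F T u = fps_nth P 3"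
    using bspec[OF 3, of 0] by (simp add: A3_def P_def fps_expansion_def scaleC.zero_left eval_nat_numeral)
  show "A4 F T u = fps_nth P 4"
    using bspec[OF 4, of 0] by (simp add: A4_def P_def fps_expansion_def scaleC.zero_left eval_nat_numeral)
qed

lemma support_functional_unit: "T \<in> support_functionals x \<Longrightarrow> blinfun_apply T \<in> unit_functionals"
  by (auto simp: support_functionals_def unit_functionals_def)

lemma holomorphic_scalar_along_line:
  fixes g :: "'a::complex_normed_space \<Rightarrow> complex"
  assumes "open S" "frechet_holomorphic_on g S"
  shows "(\<lambda>z. g (y + z *\<^sub>C v)) holomorphic_on {z. y + z *\<^sub>C v \<in> S}"
proof -
  have "blinfun_apply id_blinfun \<in> (unit_functionals :: (complex \<Rightarrow> complex) set)"
    unfolding unit_functionals_def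
    by (rule CollectI, rule exI[of _ id_blinfun]) (simp add: scaleC_complex_def norm_blinfun_id)
  from holomorphic_along_line[OF assms this] show ?thesis by simp
qed

lemma holomorphic_scalar_ray:
  fixes g :: "'a::complex_normed_space \<Rightarrow> complex"
  assumes g: "frechet_holomorphic_on g (ball 0 1)" and u: "norm u = 1"
  shows "(\<lambda>z. g (z *\<^sub>C u)) holomorphic_on ball 0 1"
  using holomorphic_scalar_along_line[OF open_ball g, of 0 u] u by (simp add: norm_scaleC ball_def)

text \<open>Since T (F (z u)) = z g (z u), the indices shift by one: A2, A3, A4 are the coefficients
  1, 2, 3 of g on the line.\<close>

lemma H22_radial:
  fixes F :: "'a::complex_banach \<Rightarrow> 'a"
  assumes F: "frechet_holomorphic_on F (ball 0 1)" and g: "frechet_holomorphic_on g (ball 0 1)"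
    and Fg: "\<forall>x\<in>ball 0 1. F x = g x *\<^sub>C x" and u: "norm u = 1" and T: "T \<in> support_functionals u"
  defines "P \<equiv> fps_expansion (\<lambda>z. g (z *\<^sub>C u)) 0"
  shows "H22 F T u = fps_nth P 1 * fps_nth P 3 - (fps_nth P 2)\<^sup>2"
proof -
  have "T (F (z *\<^sub>C u)) = z * g (z *\<^sub>C u)" if "z \<in> ball 0 1" for z
    using that T u Fg by (simp add: support_functionals_def norm_scaleC mult.commute)
  then have "\<forall>\<^sub>F z in nhds 0. T (F (z *\<^sub>C u)) = z * g (z *\<^sub>C u)"
    using eventually_nhds_in_open[of "ball 0 1" "0::complex"] by (auto elim: eventually_mono)
  moreover have "(\<lambda>z. g (z *\<^sub>C u)) has_fps_expansion P"
    unfolding P_def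
    by (rule has_fps_expansion_fps_expansion[OF open_ball _ holomorphic_scalar_ray[OF g u]]) simp
  then have "(\<lambda>z. z * g (z *\<^sub>C u)) has_fps_expansion fps_X * P"
    by (intro fps_expansion_intros)
  ultimately have "(\<lambda>z. T (F (z *\<^sub>C u))) has_fps_expansion fps_X * P"
    by (simp cong: has_fps_expansion_cong)
  then have "fps_expansion (\<lambda>z. T (F (z *\<^sub>C u))) 0 = fps_X * P"
    by (rule fps_expansion_eqI)
  then show ?thesis
    using coefficients_along_line[OF F support_functional_unit[OF T], of u] u
    by (simp add: H22_def eval_nat_numeral)
qed

section \<open>The Hankel determinant of a starlike function of one variable\<close>

text \<open>The Schwarz lemma bounds f z / z away from 0 and deriv f 0 at the origin. Only \<le> 1
  survives, as the quotient may be a unimodular constant.\<close>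

lemma schwarz_quotient:
  assumes f: "f holomorphic_on ball 0 1" "f 0 = 0" and b: "\<And>z. cmod z < 1 \<Longrightarrow> cmod (f z) < 1"
  obtains h where "h holomorphic_on ball 0 1" "\<And>z. cmod z < 1 \<Longrightarrow> cmod (h z) \<le> 1"
    "\<And>z. cmod z < 1 \<Longrightarrow> f z = z * h z"
proof -
  obtain h where h: "h holomorphic_on ball 0 1" "\<And>z. cmod z < 1 \<Longrightarrow> f z = z * h z" "deriv f 0 = h 0"
    by (rule Schwarz3[OF f]) blast
  have "cmod (h z) \<le> 1" if z: "cmod z < 1" for z
  proof (cases "z = 0")
    case True
    then show ?thesis using Schwarz_Lemma(2)[OF f b z] h(3) by simp
  next
    case False
    then show ?thesis using Schwarz_Lemma(1)[OF f b z] h(2)[OF z] by (simp add: norm_mult)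
  qed
  with h show ?thesis by (intro that)
qed

text \<open>One step of the Schur algorithm, written without the quotient.\<close>

lemma schur_step:
  assumes f: "f holomorphic_on ball 0 1" and b: "\<And>z. cmod z < 1 \<Longrightarrow> cmod (f z) \<le> 1"
  obtains h where "h holomorphic_on ball 0 1" "\<And>z. cmod z < 1 \<Longrightarrow> cmod (h z) \<le> 1"
    "\<And>z. cmod z < 1 \<Longrightarrow> f z * (1 + cnj (f 0) * z * h z) = f 0 + z * h z"
\<comment> \<open>If the modulus 1 is attained, the maximum principle makes f constant and h = 0
  satisfies the identity. Otherwise a Moebius map sends f 0 to 0 and \<open>schwarz_quotient\<close>
  applies.\<close>
proof (cases "\<exists>z\<in>ball 0 1. cmod (f z) = 1")
  case True
  then obtain w where w: "cmod w < 1" "cmod (f w) = 1" by auto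
  obtain s where s: "0 < s" "ball w s \<subseteq> ball 0 1"
    using w open_ball[of "0::complex" 1] openE by (metis mem_ball_0)
  have "f constant_on ball 0 1"
    by (rule Schwarz2[OF f s]) (use b s w in \<open>force simp: subset_iff dist_norm\<close>)
  then obtain c where c: "\<And>z. z \<in> ball 0 1 \<Longrightarrow> f z = c"
    unfolding constant_on_def by blast
  show ?thesis by (rule that[of "\<lambda>_. 0"]) (use c in auto)
next
  case False
  then have lt: "cmod (f z) < 1" if "cmod z < 1" for z
    using b[OF that] that by (force simp: less_le)
  define a where "a = f 0"
  have a: "cmod a < 1" using lt[of 0] by (simp add: a_def)
  have ne: "1 - cnj a * f z \<noteq> 0" if "cmod z < 1" for z
  proof
    assume "1 - cnj a * f z = 0"
    then have "cmod a * cmod (f z) = 1" by (metis complex_mod_cnj norm_mult norm_one right_minus_eq)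
    moreover have "cmod a * cmod (f z) < 1 * 1"
      using a lt[OF that] by (intro mult_strict_mono') auto
    ultimately show False by simp
  qed
  define m where "m z = Moebius_function 0 a (f z)" for z
  have m: "m z = (f z - a) / (1 - cnj a * f z)" for z by (simp add: m_def Moebius_function_def)
  have "m holomorphic_on ball 0 1"
    unfolding m[abs_def] using ne by (intro holomorphic_intros f) auto
  moreover have "m 0 = 0" by (simp add: m a_def)
  moreover have "cmod (m z) < 1" if "cmod z < 1" for z
    unfolding m_def by (rule Moebius_function_norm_lt_1[OF a lt[OF that]])
  ultimately obtain h where h: "h holomorphic_on ball 0 1" "\<And>z. cmod z < 1 \<Longrightarrow> cmod (h z) \<le> 1"
      "\<And>z. cmod z < 1 \<Longrightarrow> m z = z * h z"
    using schwarz_quotient by metis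
  have "f z * (1 + cnj a * z * h z) = a + z * h z" if "cmod z < 1" for z
    using h(3)[OF that] ne[OF that] by (simp add: m field_simps)
  with h show ?thesis by (intro that[of h]) (auto simp: a_def)
qed

lemma fps_identity:
  assumes "f holomorphic_on ball 0 1" "g holomorphic_on ball 0 1" "\<And>z. z \<in> ball 0 1 \<Longrightarrow> f z = g z"
    "f has_fps_expansion F" "g has_fps_expansion G"
  shows "F = G"
proof -
  have "\<forall>\<^sub>F z in nhds 0. f z = g z"
    using eventually_nhds_in_open[of "ball 0 1" "0::complex"] assms(3) by (auto elim: eventually_mono)
  then have "g has_fps_expansion F" using assms(4) by (simp cong: has_fps_expansion_cong)
  then show ?thesis using assms(5) fps_expansion_unique_complex by blast
qed

lemma schur_step_coefficients:
  assumes f: "f holomorphic_on ball 0 1" and h: "h holomorphic_on ball 0 1"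
    and eq: "\<And>z. cmod z < 1 \<Longrightarrow> f z * (1 + cnj (f 0) * z * h z) = f 0 + z * h z"
  shows "fps_nth (fps_expansion f 0) 0 = f 0 \<and>
    fps_nth (fps_expansion f 0) 1 = (1 - f 0 * cnj (f 0)) * fps_nth (fps_expansion h 0) 0 \<and>
    fps_nth (fps_expansion f 0) 2 = (1 - f 0 * cnj (f 0)) *
      (fps_nth (fps_expansion h 0) 1 - cnj (f 0) * (fps_nth (fps_expansion h 0) 0)\<^sup>2)"
proof -
  let ?F = "fps_expansion f 0" and ?H = "fps_expansion h 0"
  have "f has_fps_expansion ?F" "h has_fps_expansion ?H"
    using f h by (intro has_fps_expansion_fps_expansion[of "ball 0 1"]; simp)+
  then have "(\<lambda>z. f z * (1 + cnj (f 0) * z * h z)) has_fps_expansion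
      ?F * (1 + fps_const (cnj (f 0)) * fps_X * ?H)"
    and "(\<lambda>z. f 0 + z * h z) has_fps_expansion fps_const (f 0) + fps_X * ?H"
    by (auto intro!: fps_expansion_intros)
  then have F_eq: "?F * (1 + fps_const (cnj (f 0)) * fps_X * ?H) = fps_const (f 0) + fps_X * ?H"
    by (rule fps_identity[rotated 3]) (use f h eq in \<open>auto intro!: holomorphic_intros\<close>)
  have 0: "fps_nth ?F 0 = f 0" by (simp add: fps_expansion_def)
  have "fps_nth (?F * (1 + fps_const (cnj (f 0)) * fps_X * ?H)) 1 = fps_nth (fps_const (f 0) + fps_X * ?H) 1"
    "fps_nth (?F * (1 + fps_const (cnj (f 0)) * fps_X * ?H)) 2 = fps_nth (fps_const (f 0) + fps_X * ?H) 2"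
    by (simp_all only: F_eq)
  then have 1: "fps_nth ?F 1 + f 0 * cnj (f 0) * fps_nth ?H 0 = fps_nth ?H 0"
    and 2: "fps_nth ?F 2 + fps_nth ?F 1 * cnj (f 0) * fps_nth ?H 0 + f 0 * cnj (f 0) * fps_nth ?H 1
      = fps_nth ?H 1"
    by (simp_all add: 0 fps_mult_nth numeral_2_eq_2 mult_ac add_ac)
  from 1 have F1: "fps_nth ?F 1 = (1 - f 0 * cnj (f 0)) * fps_nth ?H 0"
    by (simp add: algebra_simps)
  from 2 have "fps_nth ?F 2 = (1 - f 0 * cnj (f 0)) * (fps_nth ?H 1 - cnj (f 0) * (fps_nth ?H 0)\<^sup>2)"
    unfolding F1 by (simp add: algebra_simps power2_eq_square)
  with 0 F1 show ?thesis by simp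
qed

text \<open>Two Schur steps give b = h1 0 and c = h2 0. The function f stands for w / z, so the
  coefficients 0, 1, 2 of W are w1, w2, w3 of the overview.\<close>

lemma schur_coefficients:
  assumes f: "f holomorphic_on ball 0 1" and b: "\<And>z. cmod z < 1 \<Longrightarrow> cmod (f z) \<le> 1"
  defines "W \<equiv> fps_expansion f 0"
  obtains b c :: complex where "cmod (fps_nth W 0) \<le> 1" "cmod b \<le> 1" "cmod c \<le> 1"
    "fps_nth W 1 = (1 - (cmod (fps_nth W 0))\<^sup>2) * b"
    "fps_nth W 2 = (1 - (cmod (fps_nth W 0))\<^sup>2) * ((1 - (cmod b)\<^sup>2) * c - cnj (fps_nth W 0) * b\<^sup>2)"
proof -
  obtain h1 where h1: "h1 holomorphic_on ball 0 1" "\<And>z. cmod z < 1 \<Longrightarrow> cmod (h1 z) \<le> 1"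
      "\<And>z. cmod z < 1 \<Longrightarrow> f z * (1 + cnj (f 0) * z * h1 z) = f 0 + z * h1 z"
    using schur_step[OF f b] by blast
  obtain h2 where h2: "h2 holomorphic_on ball 0 1" "\<And>z. cmod z < 1 \<Longrightarrow> cmod (h2 z) \<le> 1"
      "\<And>z. cmod z < 1 \<Longrightarrow> h1 z * (1 + cnj (h1 0) * z * h2 z) = h1 0 + z * h2 z"
    using schur_step[OF h1(1,2)] by blast
  have sq: "complex_of_real (1 - (cmod a)\<^sup>2) = 1 - a * cnj a" for a
    using complex_norm_square[of a] by simp
  have h2_0: "fps_nth (fps_expansion h2 0) 0 = h2 0" by (simp add: fps_expansion_def)
  show ?thesis
    by (rule that[of "h1 0" "h2 0"])
      (use schur_step_coefficients[OF f h1(1,3)] schur_step_coefficients[OF h1(1) h2(1,3)] b[of 0] h1(2)[of 0] h2(2)[of 0]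
        in \<open>simp_all add: W_def sq h2_0 del: of_real_diff\<close>)
qed

text \<open>After substitution a factor 1 - \<bar>a\<bar>^2 splits off from all terms but the last.
  The triangle inequality leaves a real inequality in s = \<bar>a\<bar> and t = \<bar>b\<bar>, which
  closes with (1 - s^2) (1 + s^2) + s^4 = 1.\<close>

lemma schur_form_bound:
  fixes a b c :: complex and k :: real
  assumes a: "cmod a \<le> 1" and b: "cmod b \<le> 1" and c: "cmod c \<le> 1" and k: "\<bar>k\<bar> \<le> 1"
    and w2: "w2 = (1 - (cmod a)\<^sup>2) * b"
    and w3: "w3 = (1 - (cmod a)\<^sup>2) * ((1 - (cmod b)\<^sup>2) * c - cnj a * b\<^sup>2)"
  shows "cmod (4 / 3 * a * w3 + 2 / 3 * a\<^sup>2 * w2 - w2\<^sup>2 + k * a ^ 4) \<le> 1"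
proof -
  define s t where "s = cmod a" and "t = cmod b"
  have s: "0 \<le> s" "s \<le> 1" and t: "0 \<le> t" "t \<le> 1" using a b by (auto simp: s_def t_def)
  have s2: "0 \<le> 1 - s\<^sup>2" and t2: "0 \<le> 1 - t\<^sup>2" using s t by (simp_all add: power_le_one)
  have aa: "a * cnj a = of_real (s\<^sup>2)" using complex_norm_square[of a] by (simp add: s_def)
  \<comment> \<open>The b^2 terms of w3 and w2^2 have the same sign and combine: 4/3 s^2 + (1 - s^2)
    = 1 + s^2 / 3.\<close>
  have split: "4 / 3 * a * w3 + 2 / 3 * a\<^sup>2 * w2 - w2\<^sup>2 + k * a ^ 4 =
      of_real (1 - s\<^sup>2) * (of_real (4 / 3 * (1 - t\<^sup>2)) * a * c - of_real (1 + s\<^sup>2 / 3) * b\<^sup>2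
        + of_real (2 / 3) * a\<^sup>2 * b) + of_real k * a ^ 4"
  proof -
    have e1: "4 / 3 * a * w3 = of_real (1 - s\<^sup>2) * (of_real (4 / 3 * (1 - t\<^sup>2)) * a * c - 4 / 3 * (a * cnj a) * b\<^sup>2)"
    proof -
      have "4 / 3 * a * (S * (X * c - cnj a * b\<^sup>2)) = S * (4 / 3 * X * a * c - 4 / 3 * (a * cnj a) * b\<^sup>2)"
        for S X :: complex
        by (simp add: algebra_simps)
      then show ?thesis
        by (simp only: w3 flip: s_def t_def) (simp only: of_real_mult of_real_divide of_real_numeral)
    qed
    have e2: "w2\<^sup>2 = of_real (1 - s\<^sup>2) * (of_real (1 - s\<^sup>2) * b\<^sup>2)"
      by (simp add: w2 s_def power2_eq_square)
    have e3: "2 / 3 * a\<^sup>2 * w2 = of_real (1 - s\<^sup>2) * (2 / 3 * a\<^sup>2 * b)"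
      by (simp add: w2 s_def)
    show ?thesis unfolding e1 e2 e3 aa by (simp add: field_simps)
  qed
  have "cmod (4 / 3 * a * w3 + 2 / 3 * a\<^sup>2 * w2 - w2\<^sup>2 + k * a ^ 4)
      \<le> (1 - s\<^sup>2) * (4 / 3 * (1 - t\<^sup>2) * s * 1 + (1 + s\<^sup>2 / 3) * t\<^sup>2 + 2 / 3 * s\<^sup>2 * t) + 1 * s ^ 4"
  proof -
    have 1: "cmod (of_real k * a ^ 4) \<le> 1 * s ^ 4"
      using mult_right_mono[OF k, of "s ^ 4"] s by (simp add: norm_mult norm_power flip: s_def)
    have 2: "cmod (of_real (4 / 3 * (1 - t\<^sup>2)) * a * c) \<le> 4 / 3 * (1 - t\<^sup>2) * s * 1"
      unfolding norm_mult norm_of_real using t2 c s by (intro mult_mono) (auto simp: s_def)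
    have 3: "cmod (of_real (1 + s\<^sup>2 / 3) * b\<^sup>2) = (1 + s\<^sup>2 / 3) * t\<^sup>2"
      unfolding norm_mult norm_of_real norm_power t_def by simp
    have 4: "cmod (of_real (2 / 3) * a\<^sup>2 * b) = 2 / 3 * s\<^sup>2 * t"
      unfolding norm_mult norm_of_real norm_power t_def s_def by simp
    let ?z = "of_real (4 / 3 * (1 - t\<^sup>2)) * a * c - of_real (1 + s\<^sup>2 / 3) * b\<^sup>2 + of_real (2 / 3) * a\<^sup>2 * b"
    have "cmod ?z \<le> 4 / 3 * (1 - t\<^sup>2) * s * 1 + (1 + s\<^sup>2 / 3) * t\<^sup>2 + 2 / 3 * s\<^sup>2 * t"
      by (rule norm_triangle_le, rule add_mono, rule order_trans[OF norm_triangle_ineq4], rule add_mono)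
        (use 2 3 4 in simp_all)
    then have "cmod (of_real (1 - s\<^sup>2) * ?z) \<le>
        (1 - s\<^sup>2) * (4 / 3 * (1 - t\<^sup>2) * s * 1 + (1 + s\<^sup>2 / 3) * t\<^sup>2 + 2 / 3 * s\<^sup>2 * t)"
      unfolding norm_mult norm_of_real using s2 by (simp add: mult_left_mono)
    with 1 show ?thesis unfolding split by (intro norm_triangle_le add_mono)
  qed
  also have "\<dots> \<le> (1 - s\<^sup>2) * (1 + s\<^sup>2) + 1 * s ^ 4"
  proof -
    \<comment> \<open>The coefficient of \<open>t\<^sup>2\<close> is \<open>(1 - s) * (3 - s) / 3\<close>, so the left factor is largest at \<open>t = 1\<close>.\<close>
    have "4 / 3 * (1 - t\<^sup>2) * s * 1 + (1 + s\<^sup>2 / 3) * t\<^sup>2 + 2 / 3 * s\<^sup>2 * t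
        = 1 + s\<^sup>2 - ((1 - s) * (3 - s) / 3 * (1 - t\<^sup>2) + 2 / 3 * s\<^sup>2 * (1 - t))" (is "?l = _ - ?r")
      by (simp add: power2_eq_square algebra_simps add_divide_distrib diff_divide_distrib)
    moreover have "0 \<le> (1 - s) * (3 - s) / 3 * (1 - t\<^sup>2)"
      by (rule mult_nonneg_nonneg[OF _ t2]) (use s in simp)
    moreover have "0 \<le> 2 / 3 * s\<^sup>2 * (1 - t)"
      by (rule mult_nonneg_nonneg) (use t in simp_all)
    ultimately have "?l \<le> 1 + s\<^sup>2" by linarith
    then show ?thesis unfolding add_le_cancel_right by (rule mult_left_mono[OF _ s2])
  qed
  also have "\<dots> = 1" by (simp add: algebra_simps power4_eq_xxxx power2_eq_square)
  finally show ?thesis .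
qed

lemma hankel_bound:
  assumes p: "p holomorphic_on ball 0 1" and p0: "p 0 = 1" and \<alpha>: "0 \<le> \<alpha>" "\<alpha> < 1"
    and nz: "\<And>z. cmod z < 1 \<Longrightarrow> p z \<noteq> 0"
    and Re: "\<And>z. cmod z < 1 \<Longrightarrow> Re ((p z + z * deriv p z) / p z) > \<alpha>"
  defines "P \<equiv> fps_expansion p 0"
  shows "cmod (fps_nth P 1 * fps_nth P 3 - (fps_nth P 2)\<^sup>2) \<le> (1 - \<alpha>)\<^sup>2"
proof -
  define \<beta> where "\<beta> = 1 - \<alpha>"
  have \<beta>: "0 < \<beta>" "\<beta> \<le> 1" using \<alpha> by (auto simp: \<beta>_def)
  define r where "r z = z * deriv p z / p z" for z
  have Rer: "Re (r z) > - \<beta>" if "cmod z < 1" for z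
    using Re[OF that] nz[OF that] by (simp add: r_def \<beta>_def add_divide_distrib)
  have dp: "deriv p holomorphic_on ball 0 1" by (rule holomorphic_deriv[OF p]) simp
  have r: "r holomorphic_on ball 0 1"
    unfolding r_def[abs_def] using nz by (intro holomorphic_intros p dp) auto
  \<comment> \<open>A point with real part above - \<beta> is closer to 0 than to - 2
    \<beta>.\<close>
  have lt: "cmod (r z) < cmod (r z + 2 * \<beta>)" if "cmod z < 1" for z
  proof (rule power2_less_imp_less)
    have "(cmod (r z + 2 * \<beta>))\<^sup>2 - (cmod (r z))\<^sup>2 = 4 * \<beta> * (Re (r z) + \<beta>)"
      unfolding cmod_power2 by (simp add: power2_eq_square algebra_simps)
    moreover have "4 * \<beta> * (Re (r z) + \<beta>) > 0"
      using Rer[OF that] \<beta> by (intro mult_pos_pos) auto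
    ultimately show "(cmod (r z))\<^sup>2 < (cmod (r z + 2 * \<beta>))\<^sup>2" by linarith
  qed simp
  have ne: "r z + 2 * \<beta> \<noteq> 0" if "cmod z < 1" for z
    using lt[OF that] norm_ge_zero[of "r z"] by (metis norm_zero not_le)
  \<comment> \<open>This solves r = 2 \<beta> \<omega> / (1 - \<omega>) for the Schwarz
    function.\<close>
  define \<omega> where "\<omega> z = r z / (r z + 2 * \<beta>)" for z
  have "\<omega> holomorphic_on ball 0 1"
    unfolding \<omega>_def[abs_def] using ne by (intro holomorphic_intros r) auto
  moreover have "\<omega> 0 = 0" by (simp add: \<omega>_def r_def)
  moreover have "cmod (\<omega> z) < 1" if "cmod z < 1" for z
    using lt[OF that] ne[OF that] by (simp add: \<omega>_def norm_divide divide_less_eq)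
  ultimately obtain \<psi> where \<psi>: "\<psi> holomorphic_on ball 0 1" "\<And>z. cmod z < 1 \<Longrightarrow> cmod (\<psi> z) \<le> 1"
      "\<And>z. cmod z < 1 \<Longrightarrow> \<omega> z = z * \<psi> z"
    using schwarz_quotient by metis
  \<comment> \<open>Denominators are cleared, so that only products of power series occur. The
    common factor z is kept here and cancelled for formal series, where no exception at z = 0
    arises.\<close>
  have eq: "z * deriv p z = z * (\<psi> z * (z * deriv p z + 2 * \<beta> * p z))" if z: "cmod z < 1" for z
  proof -
    have "r z = z * \<psi> z * (r z + 2 * \<beta>)"
      using \<psi>(3)[OF z] ne[OF z] by (simp add: \<omega>_def field_simps)
    then have "r z * p z = z * \<psi> z * (r z * p z + 2 * \<beta> * p z)"
      by (metis (no_types, lifting) mult.assoc distrib_right)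
    moreover have "r z * p z = z * deriv p z" using nz[OF z] by (simp add: r_def)
    ultimately show ?thesis by (simp add: mult.assoc)
  qed
  define W where "W = fps_expansion \<psi> 0"
  have P: "p has_fps_expansion P" and W: "\<psi> has_fps_expansion W"
    unfolding P_def W_def using p \<psi>(1) by (intro has_fps_expansion_fps_expansion[of "ball 0 1"]; simp)+
  have "(\<lambda>z. z * deriv p z) has_fps_expansion fps_X * fps_deriv P"
    and "(\<lambda>z. z * (\<psi> z * (z * deriv p z + 2 * \<beta> * p z))) has_fps_expansion
      fps_X * (W * (fps_X * fps_deriv P + fps_const (2 * \<beta>) * P))"
    using P W by (auto intro!: fps_expansion_intros)
  then have "fps_X * fps_deriv P = fps_X * (W * (fps_X * fps_deriv P + fps_const (2 * \<beta>) * P))"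
    by (rule fps_identity[rotated 3]) (use p dp \<psi> eq in \<open>auto intro!: holomorphic_intros\<close>)
  then have fps: "fps_deriv P = W * (fps_X * fps_deriv P + fps_const (2 * \<beta>) * P)"
    by simp
  let ?P = "fps_nth P" and ?w = "fps_nth W"
  have P0: "?P 0 = 1" by (simp add: P_def fps_expansion_def p0)
  \<comment> \<open>The recurrence is (n + 1) P_(n+1) = sum over i \<le> n of w_i (n - i + 2
    \<beta>) P_(n-i), with w_i the coefficients of W.\<close>
  have nth: "fps_nth (fps_deriv P) n = fps_nth (W * (fps_X * fps_deriv P + fps_const (2 * \<beta>) * P)) n" for n
    using fps by simp
  have 1: "?P 1 = 2 * \<beta> * ?w 0"
    using nth[of 0] by (simp add: P0)
  have 2: "2 * ?P 2 = ?w 0 * ((1 + 2 * \<beta>) * ?P 1) + ?w 1 * (2 * \<beta>)"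
    using nth[of 1] by (simp add: P0 fps_mult_nth numeral_2_eq_2 algebra_simps)
  have 3: "3 * ?P 3 = ?w 0 * ((2 + 2 * \<beta>) * ?P 2) + ?w 1 * ((1 + 2 * \<beta>) * ?P 1) + ?w 2 * (2 * \<beta>)"
    using nth[of 2] by (simp add: P0 fps_mult_nth numeral_2_eq_2 numeral_3_eq_3 algebra_simps)
  have "2 * ?P 2 = 2 * (\<beta> * ((1 + 2 * \<beta>) * (?w 0)\<^sup>2 + ?w 1))"
    unfolding 2 1 by (simp add: algebra_simps power2_eq_square)
  then have P2: "?P 2 = \<beta> * ((1 + 2 * \<beta>) * (?w 0)\<^sup>2 + ?w 1)"
    by (simp only: mult_cancel_left) simp
  have "3 * ?P 3 = 2 * \<beta> * ((1 + \<beta>) * (1 + 2 * \<beta>) * ?w 0 ^ 3 + (2 + 3 * \<beta>) * ?w 0 * ?w 1 + ?w 2)"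
    unfolding 3 1 P2 by (simp add: algebra_simps power2_eq_square power3_eq_cube)
  then have P3: "?P 3 = 2 * \<beta> * ((1 + \<beta>) * (1 + 2 * \<beta>) * ?w 0 ^ 3 + (2 + 3 * \<beta>) * ?w 0 * ?w 1 + ?w 2) / 3"
    by (simp only: eq_divide_eq) (simp add: mult.commute)
  obtain b c :: complex where bc: "cmod (?w 0) \<le> 1" "cmod b \<le> 1" "cmod c \<le> 1"
    "?w 1 = (1 - (cmod (?w 0))\<^sup>2) * b"
    "?w 2 = (1 - (cmod (?w 0))\<^sup>2) * ((1 - (cmod b)\<^sup>2) * c - cnj (?w 0) * b\<^sup>2)"
    by (rule schur_coefficients[OF \<psi>(1), folded W_def], erule \<psi>(2), rule that)
  \<comment> \<open>For 0 < \<beta> \<le> 1 the value lies between -1, attained at \<beta> = 1, and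
    1/3.\<close>
  have k: "\<bar>(1 - 4 * \<beta>\<^sup>2) / 3\<bar> \<le> 1"
  proof -
    have "\<beta>\<^sup>2 \<le> 1" using \<beta> by (simp add: power_le_one)
    then show ?thesis using zero_le_power2[of \<beta>] by (simp add: abs_le_iff field_simps)
  qed
  let ?E = "4 / 3 * ?w 0 * ?w 2 + 2 / 3 * (?w 0)\<^sup>2 * ?w 1 - (?w 1)\<^sup>2 + of_real ((1 - 4 * \<beta>\<^sup>2) / 3) * ?w 0 ^ 4"
  have "?P 1 * ?P 3 - (?P 2)\<^sup>2 = of_real (\<beta>\<^sup>2) * ?E"
  proof -
    have "2 * B * a * (2 * B * ((1 + B) * (1 + 2 * B) * a ^ 3 + (2 + 3 * B) * a * x + y) / 3)
        - (B * ((1 + 2 * B) * a\<^sup>2 + x))\<^sup>2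
        = B\<^sup>2 * (4 / 3 * a * y + 2 / 3 * a\<^sup>2 * x - x\<^sup>2 + (1 - 4 * B\<^sup>2) / 3 * a ^ 4)" for B a x y :: complex
      by (simp add: field_simps power2_eq_square power3_eq_cube power4_eq_xxxx)
    from this[of "of_real \<beta>" "?w 0" "?w 1" "?w 2"] show ?thesis
      unfolding 1 P2 P3 by simp
  qed
  then have "cmod (?P 1 * ?P 3 - (?P 2)\<^sup>2) = \<beta>\<^sup>2 * cmod ?E"
    by (simp only: norm_mult norm_of_real) simp
  also have "\<dots> \<le> \<beta>\<^sup>2 * 1"
    by (rule mult_left_mono[OF schur_form_bound[OF bc(1-3) k bc(4,5)]]) simp
  finally show ?thesis by (simp add: \<beta>_def)
qed

section \<open>Radial starlike mappings\<close>

text \<open>Inversion maps the half-plane Re > \<alpha> to the disc with centre and radius 1 / (2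
  \<alpha>), or to the right half-plane if \<alpha> = 0. For c \<noteq> 0 both forms say \<alpha>
  \<bar>c\<bar>^2 < Re c; the point c = 0 lies on the boundary and fails both.\<close>

lemma starlike_condition_iff:
  assumes \<alpha>: "0 \<le> \<alpha>" and r: "0 < r"
  shows "(if \<alpha> = 0 then Re (c * of_real r) > 0
      else cmod (c * of_real r / of_real r - of_real (1 / (2 * \<alpha>))) < 1 / (2 * \<alpha>)) \<longleftrightarrow>
    c \<noteq> 0 \<and> Re (1 / c) > \<alpha>"
proof (cases "c = 0")
  case True
  then show ?thesis using \<alpha> by (simp add: norm_divide norm_mult)
next
  case False
  then have c: "0 < (cmod c)\<^sup>2" by simp
  have Re: "Re (1 / c) > \<alpha> \<longleftrightarrow> \<alpha> * (cmod c)\<^sup>2 < Re c"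
    using c unfolding cmod_power2 by (simp add: Re_divide pos_less_divide_eq)
  show ?thesis
  proof (cases "\<alpha> = 0")
    case True
    then show ?thesis using Re False r by (simp add: zero_less_mult_iff)
  next
    case nz: False
    with \<alpha> have \<alpha>: "0 < \<alpha>" by simp
    let ?a = "1 / (2 * \<alpha>)"
    have "cmod (c - of_real ?a) < ?a \<longleftrightarrow> (cmod (c - of_real ?a))\<^sup>2 < ?a\<^sup>2"
      using \<alpha> by (auto intro: power2_less_imp_less power_strict_mono)
    also have "(cmod (c - of_real ?a))\<^sup>2 = (cmod c)\<^sup>2 - 2 * ?a * Re c + ?a\<^sup>2"
      unfolding cmod_power2 by (simp add: power2_diff)
    also have "\<dots> < ?a\<^sup>2 \<longleftrightarrow> (cmod c)\<^sup>2 < Re c / \<alpha>" by simp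
    also have "\<dots> \<longleftrightarrow> \<alpha> * (cmod c)\<^sup>2 < Re c"
      using \<alpha> by (simp add: pos_less_divide_eq mult.commute)
    finally show ?thesis using Re False nz r by simp
  qed
qed

context
  fixes g :: "'a::complex_banach \<Rightarrow> complex" and F :: "'a \<Rightarrow> 'a" and x :: 'a and Dg :: "'a \<Rightarrow> complex"
  assumes x: "x \<in> ball 0 1" and Fg: "\<forall>x\<in>ball 0 1. F x = g x *\<^sub>C x"
    and Dg: "(g has_derivative Dg) (at x)" "\<And>c v. Dg (c *\<^sub>C v) = c * Dg v"
begin

lemma radial_has_derivative: "(F has_derivative (\<lambda>h. g x *\<^sub>C h + Dg h *\<^sub>C x)) (at x)"
proof -
  have "((\<lambda>x. g x *\<^sub>C x) has_derivative (\<lambda>h. g x *\<^sub>C h + Dg h *\<^sub>C x)) (at x)"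
    by (rule scaleC.FDERIV[OF Dg(1) has_derivative_ident])
  then show ?thesis
    by (rule has_derivative_transform_within_open[OF _ open_ball x]) (use Fg in simp)
qed

lemma fderiv_radial: "fderiv F x h = g x *\<^sub>C h + Dg h *\<^sub>C x"
  by (simp add: fderiv_eqI[OF radial_has_derivative])

text \<open>The vector x is an eigenvector of DF(x) with eigenvalue g x + Dg x, nonzero by
  injectivity, and F x lies on the same complex line.\<close>

lemma inv_fderiv_radial:
  assumes nz: "x \<noteq> 0" and bij: "bij (blinfun_apply (fderiv F x))"
  shows "g x + Dg x \<noteq> 0"
    and "inv (blinfun_apply (fderiv F x)) (F x) = (g x / (g x + Dg x)) *\<^sub>C x"
proof -
  have DF: "fderiv F x (c *\<^sub>C x) = (c * (g x + Dg x)) *\<^sub>C x" for c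
    by (simp add: fderiv_radial Dg(2) scaleC_scaleC algebra_simps flip: scaleC_add_left)
  show ne: "g x + Dg x \<noteq> 0"
  proof
    assume "g x + Dg x = 0"
    then have "fderiv F x x = fderiv F x 0" using DF[of 1] by (simp add: scaleC.zero_left)
    then show False using bij nz by (meson bij_is_inj injD)
  qed
  show "inv (blinfun_apply (fderiv F x)) (F x) = (g x / (g x + Dg x)) *\<^sub>C x"
    by (rule inv_f_eq[OF bij_is_inj[OF bij]]) (use DF Fg x ne in simp)
qed

text \<open>All support functionals of x agree on multiples of x, so the condition does not depend
  on T: one functional is enough to extract it, and one computation verifies it for all.\<close>

lemma radial_starlike_condition:
  assumes nz: "x \<noteq> 0" and bij: "bij (blinfun_apply (fderiv F x))"
    and T: "T \<in> support_functionals x" and \<alpha>: "0 \<le> \<alpha>"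
  shows "(let w = blinfun_apply T (inv (blinfun_apply (fderiv F x)) (F x)) in
      if \<alpha> = 0 then Re w > 0
      else cmod (w / of_real (norm x) - of_real (1 / (2 * \<alpha>))) < 1 / (2 * \<alpha>)) \<longleftrightarrow>
    g x \<noteq> 0 \<and> Re ((g x + Dg x) / g x) > \<alpha>"
proof -
  have w: "blinfun_apply T (inv (blinfun_apply (fderiv F x)) (F x)) = g x / (g x + Dg x) * of_real (norm x)"
    using T unfolding inv_fderiv_radial(2)[OF nz bij] by (simp add: support_functionals_def)
  show ?thesis
    unfolding w Let_def using starlike_condition_iff[OF \<alpha>, of "norm x" "g x / (g x + Dg x)"] nz
      inv_fderiv_radial(1)[OF nz bij] by simp
qed

end

lemma blinfun_inverse_bij:
  assumes "G o\<^sub>L A = id_blinfun" "A o\<^sub>L G = id_blinfun"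
  shows "bij (blinfun_apply A)"
  by (rule o_bij[of "blinfun_apply G"])
    (use assms[THEN arg_cong, of blinfun_apply] in \<open>auto simp: fun_eq_iff\<close>)

lemma frechet_scalar_derivative:
  fixes g :: "'a::complex_normed_space \<Rightarrow> complex"
  assumes "frechet_holomorphic_on g S" "x \<in> S"
  obtains D where "(g has_derivative D) (at x)" "\<And>c v. D (c *\<^sub>C v) = c * D v"
  using assms unfolding frechet_holomorphic_on_def scaleC_complex_def by blast

text \<open>With f(z) = z p(z) the quotient is z f' / f, since the derivative of g at z u in
  direction z u is z p'(z). At z = 0, where the class imposes nothing, it equals 1 >
  \<alpha>.\<close>

lemma starlike_radial_ray:
  fixes F :: "'a::complex_banach \<Rightarrow> 'a"
  assumes g: "frechet_holomorphic_on g (ball 0 1)" and g0: "g 0 = 1"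
    and Fg: "\<forall>x\<in>ball 0 1. F x = g x *\<^sub>C x" and F: "F \<in> starlike_maps \<alpha>"
    and \<alpha>: "0 \<le> \<alpha>" "\<alpha> < 1" and u: "norm u = 1" and z: "cmod z < 1"
  defines "p \<equiv> \<lambda>z. g (z *\<^sub>C u)"
  shows "p z \<noteq> 0 \<and> Re ((p z + z * deriv p z) / p z) > \<alpha>"
proof (cases "z = 0")
  case True
  then show ?thesis using g0 \<alpha> by (simp add: p_def scaleC.zero_left)
next
  case False
  let ?x = "z *\<^sub>C u"
  have n: "norm ?x = cmod z" using u by (simp add: norm_scaleC)
  have x: "?x \<in> ball 0 1" using z by (simp add: n)
  have "norm ?x \<noteq> 0" using n False by simp
  then have xnz: "?x \<noteq> 0" by (metis norm_zero)
  obtain D where D: "(g has_derivative D) (at ?x)" "\<And>c v. D (c *\<^sub>C v) = c * D v"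
    by (rule frechet_scalar_derivative[OF g x]) blast
  have "((\<lambda>z. z *\<^sub>C u) has_derivative (\<lambda>h. h *\<^sub>C u)) (at z)"
    by (rule bounded_linear_imp_has_derivative[OF scaleC.bounded_linear_left])
  then have "(p has_derivative (\<lambda>h. D (h *\<^sub>C u))) (at z)"
    unfolding p_def by (rule has_derivative_compose) (rule D)
  moreover have "(\<lambda>h. D (h *\<^sub>C u)) = (*) (D u)" by (auto simp: D(2))
  ultimately have dp: "deriv p z = D u" by (intro DERIV_imp_deriv) (simp add: has_field_derivative_def)
  have "bij (blinfun_apply (fderiv F ?x))"
    using F x blinfun_inverse_bij unfolding starlike_maps_def locally_biholomorphic_def by blast
  moreover obtain T where T: "T \<in> support_functionals ?x"
    using support_functionals_nonempty[OF xnz] by blast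
  moreover have "(let w = blinfun_apply T (inv (blinfun_apply (fderiv F ?x)) (F ?x)) in
      if \<alpha> = 0 then Re w > 0
      else cmod (w / of_real (norm ?x) - of_real (1 / (2 * \<alpha>))) < 1 / (2 * \<alpha>))"
    using F T x xnz unfolding starlike_maps_def by blast
  ultimately have "g ?x \<noteq> 0 \<and> Re ((g ?x + D ?x) / g ?x) > \<alpha>"
    using radial_starlike_condition[OF x Fg D xnz _ T \<alpha>(1)] by blast
  then show ?thesis by (simp add: p_def[symmetric] dp D(2)) (simp add: p_def)
qed

section \<open>The extremal mapping\<close>

context
  fixes T :: "'a::complex_banach \<Rightarrow>\<^sub>L complex" and u :: 'a and \<alpha> :: real
  assumes T: "T \<in> support_functionals u" and u: "norm u = 1" and \<alpha>: "0 \<le> \<alpha>" "\<alpha> < 1"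
begin

text \<open>The principal branch of (1 - w^2)^(-\<beta>) with \<beta> = 1 - \<alpha>, obtained by
  integrating w p' / p = 2 \<beta> \<omega> / (1 - \<omega>) for \<omega> = w^2.\<close>

definition extremal_scalar :: "complex \<Rightarrow> complex"
  where "extremal_scalar w = exp (- of_real (1 - \<alpha>) * Ln (1 - w\<^sup>2))"

definition extremal_factor :: "'a \<Rightarrow> complex"
  where "extremal_factor x = extremal_scalar (T x)"

definition extremal_map :: "'a \<Rightarrow> 'a"
  where "extremal_map x = extremal_factor x *\<^sub>C x"

lemma one_minus_square_not_nonpos:
  assumes "cmod w < 1"
  shows "1 - w\<^sup>2 \<notin> \<real>\<^sub>\<le>\<^sub>0"
proof -
  have "Re (w\<^sup>2) \<le> cmod (w\<^sup>2)" by (rule complex_Re_le_cmod)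
  also have "\<dots> < 1" using assms by (simp add: norm_power power_less_one_iff)
  finally show ?thesis by (auto simp: complex_nonpos_Reals_iff)
qed

lemma extremal_scalar_derivative:
  assumes "cmod w < 1"
  shows "(extremal_scalar has_field_derivative
    extremal_scalar w * (2 * of_real (1 - \<alpha>) * w / (1 - w\<^sup>2))) (at w)"
proof -
  have "((\<lambda>w. exp (- b * Ln (1 - w\<^sup>2))) has_field_derivative
      exp (- b * Ln (1 - w\<^sup>2)) * (2 * b * w / (1 - w\<^sup>2))) (at w)" for b
    using one_minus_square_not_nonpos[OF assms]
    by (auto intro!: derivative_eq_intros simp: divide_inverse mult_ac)
  from this[of "of_real (1 - \<alpha>)"] show ?thesis
    unfolding extremal_scalar_def .
qed

lemma T_scaleC: "T (c *\<^sub>C v) = c * T v"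
  using T by (simp add: support_functionals_def)

lemma T_less: "x \<in> ball 0 1 \<Longrightarrow> cmod (T x) < 1"
  using norming_le[OF norming_unit_functionals support_functional_unit[OF T], of x] by simp

lemma extremal_scalar_nonzero: "extremal_scalar w \<noteq> 0"
  by (simp add: extremal_scalar_def)

text \<open>With v = w^2 the expression is \<alpha> + (1 - \<alpha>) (1 + v) / (1 - v), and the
  Cayley transform has positive real part on the disc.\<close>

lemma extremal_scalar_log_derivative:
  assumes w: "cmod w < 1"
  shows "Re (1 + w * (2 * of_real (1 - \<alpha>) * w / (1 - w\<^sup>2))) > \<alpha>"
proof -
  have v: "cmod (w\<^sup>2) < 1" using w by (simp add: norm_power power_less_one_iff)
  then have ne: "1 - w\<^sup>2 \<noteq> 0" by auto
  have "Re ((1 + w\<^sup>2) * cnj (1 - w\<^sup>2)) = 1 - (cmod (w\<^sup>2))\<^sup>2"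
    unfolding cmod_power2 by (simp add: algebra_simps power2_eq_square)
  moreover have "(cmod (w\<^sup>2))\<^sup>2 < 1" using v by (simp add: power_less_one_iff)
  ultimately have "Re ((1 + w\<^sup>2) / (1 - w\<^sup>2)) > 0" by (simp add: Re_complex_div_gt_0)
  then have "0 < (1 - \<alpha>) * Re ((1 + w\<^sup>2) / (1 - w\<^sup>2))" using \<alpha> by simp
  also have "\<dots> = Re (of_real (1 - \<alpha>) * ((1 + w\<^sup>2) / (1 - w\<^sup>2)))" by (simp only: Re_complex_of_real times_complex.sel Im_complex_of_real)
  also have "of_real (1 - \<alpha>) * ((1 + w\<^sup>2) / (1 - w\<^sup>2))
      = 1 + w * (2 * of_real (1 - \<alpha>) * w / (1 - w\<^sup>2)) - of_real \<alpha>"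
    using ne by (simp add: field_simps power2_eq_square)
  finally show ?thesis by simp
qed

definition extremal_derivative :: "'a \<Rightarrow> 'a \<Rightarrow> complex"
  where "extremal_derivative x h =
    extremal_factor x * (2 * of_real (1 - \<alpha>) * T x / (1 - (T x)\<^sup>2)) * T h"

lemma extremal_factor_derivative:
  assumes "x \<in> ball 0 1"
  shows "(extremal_factor has_derivative extremal_derivative x) (at x)"
  unfolding extremal_factor_def extremal_derivative_def
  by (rule has_derivative_compose[OF bounded_linear_imp_has_derivative[OF blinfun.bounded_linear_right]
      extremal_scalar_derivative[OF T_less[OF assms], unfolded has_field_derivative_def]])

lemma extremal_derivative_scaleC: "extremal_derivative x (c *\<^sub>C v) = c * extremal_derivative x v"
  by (simp add: extremal_derivative_def T_scaleC)

lemma extremal_derivative_nonzero: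
  assumes "x \<in> ball 0 1"
  shows "Re ((extremal_factor x + extremal_derivative x x) / extremal_factor x) > \<alpha>"
    and "extremal_factor x + extremal_derivative x x \<noteq> 0"
proof -
  have nz: "extremal_factor x \<noteq> 0" by (simp add: extremal_factor_def extremal_scalar_nonzero)
  have "extremal_factor x + extremal_derivative x x =
      extremal_factor x * (1 + T x * (2 * of_real (1 - \<alpha>) * T x / (1 - (T x)\<^sup>2)))"
    by (simp add: extremal_derivative_def algebra_simps)
  then show *: "Re ((extremal_factor x + extremal_derivative x x) / extremal_factor x) > \<alpha>"
    using extremal_scalar_log_derivative[OF T_less[OF assms]] nz by simp
  show "extremal_factor x + extremal_derivative x x \<noteq> 0"
  proof
    assume "extremal_factor x + extremal_derivative x x = 0"
    then show False using * \<alpha> by simp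
  qed
qed

lemma extremal_map_radial: "\<forall>x\<in>ball 0 1. extremal_map x = extremal_factor x *\<^sub>C x"
  by (simp add: extremal_map_def)

lemma fderiv_extremal_map:
  "x \<in> ball 0 1 \<Longrightarrow> fderiv extremal_map x h = extremal_factor x *\<^sub>C h + extremal_derivative x h *\<^sub>C x"
  by (rule fderiv_radial[OF _ extremal_map_radial extremal_factor_derivative extremal_derivative_scaleC])

lemma extremal_factor_holomorphic: "frechet_holomorphic_on extremal_factor (ball 0 1)"
  unfolding frechet_holomorphic_on_def
  using extremal_factor_derivative extremal_derivative_scaleC unfolding scaleC_complex_def by blast

lemma extremal_map_holomorphic: "frechet_holomorphic_on extremal_map (ball 0 1)"
  unfolding frechet_holomorphic_on_def
proof (intro ballI exI conjI allI)
  fix x :: 'a and c v assume x: "x \<in> ball 0 1"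
  show "(extremal_map has_derivative (\<lambda>h. extremal_factor x *\<^sub>C h + extremal_derivative x h *\<^sub>C x)) (at x)"
    by (rule radial_has_derivative[OF x extremal_map_radial extremal_factor_derivative[OF x] extremal_derivative_scaleC])
  show "extremal_factor x *\<^sub>C (c *\<^sub>C v) + extremal_derivative x (c *\<^sub>C v) *\<^sub>C x =
      c *\<^sub>C (extremal_factor x *\<^sub>C v + extremal_derivative x v *\<^sub>C x)"
    by (simp add: extremal_derivative_scaleC scaleC_add_right scaleC_scaleC mult.commute)
qed

text \<open>DF(x) is a rank-one perturbation of a nonzero multiple of the identity, inverted by the
  Sherman-Morrison formula. Its denominator d is the eigenvalue on x, nonzero by the starlikeness
  estimate.\<close>

lemma extremal_map_invertible:
  assumes x: "x \<in> ball 0 1"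
  shows "\<exists>G. G o\<^sub>L fderiv extremal_map x = id_blinfun \<and> fderiv extremal_map x o\<^sub>L G = id_blinfun"
proof -
  define g where "g = extremal_factor x"
  define e where "e = g * (2 * of_real (1 - \<alpha>) * T x / (1 - (T x)\<^sup>2))"
  have g: "g \<noteq> 0" by (simp add: g_def extremal_factor_def extremal_scalar_nonzero)
  have D: "extremal_derivative x h = e * T h" for h
    by (simp add: extremal_derivative_def e_def g_def)
  define d where "d = g + e * T x"
  have d: "d \<noteq> 0" using extremal_derivative_nonzero(2)[OF x] by (simp add: d_def g_def D)
  \<comment> \<open>Applying \<open>T\<close> to \<open>g h + e T(h) x = y\<close> gives \<open>T(h) = T(y) / d\<close>, and then \<open>h\<close>.\<close>
  define G where "G y = (1 / g) *\<^sub>C (y - (e / d * T y) *\<^sub>C x)" for y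
  have "bounded_linear G"
    unfolding G_def
    by (intro bounded_linear_compose[OF scaleC.bounded_linear_right] bounded_linear_sub bounded_linear_ident
        bounded_linear_compose[OF scaleC.bounded_linear_left] bounded_linear_const_mult blinfun.bounded_linear_right)
  then have G: "blinfun_apply (Blinfun G) = G" by (rule bounded_linear_Blinfun_apply)
  have DF: "fderiv extremal_map x h = g *\<^sub>C h + (e * T h) *\<^sub>C x" for h
    using x by (simp add: fderiv_extremal_map D g_def)
  have "T (g *\<^sub>C h + (e * T h) *\<^sub>C x) = d * T h" for h
    by (simp add: blinfun.add_right T_scaleC d_def algebra_simps)
  then have "G (fderiv extremal_map x h) = h" for h
    using g d by (simp add: DF G_def scaleC_scaleC)
  moreover have "T (G y) = T y / d" for y
    using g d by (simp add: G_def blinfun.diff_right T_scaleC field_simps) (simp add: d_def algebra_simps)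
  then have "fderiv extremal_map x (G y) = y" for y
    unfolding DF using g by (simp add: G_def scaleC_scaleC)
  ultimately show ?thesis
    by (intro exI[of _ "Blinfun G"] conjI blinfun_eqI) (simp_all add: G)
qed

lemma extremal_map_starlike: "extremal_map \<in> starlike_maps \<alpha>"
proof -
  have "fderiv extremal_map 0 = id_blinfun"
    by (rule blinfun_eqI)
      (simp add: fderiv_extremal_map extremal_derivative_def extremal_factor_def extremal_scalar_def scaleC.zero_right)
  then have "normalized extremal_map"
    by (simp add: normalized_def extremal_map_def scaleC.zero_right)
  moreover have "locally_biholomorphic extremal_map"
    using extremal_map_holomorphic extremal_map_invertible by (simp add: locally_biholomorphic_def)
  moreover have "let w = blinfun_apply S (inv (blinfun_apply (fderiv extremal_map x)) (extremal_map x)) in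
      if \<alpha> = 0 then Re w > 0
      else cmod (w / of_real (norm x) - of_real (1 / (2 * \<alpha>))) < 1 / (2 * \<alpha>)"
    if x: "x \<in> ball 0 1 - {0}" and S: "S \<in> support_functionals x" for x S
  proof -
    have b: "x \<in> ball 0 1" "x \<noteq> 0" using x by auto
    have "bij (blinfun_apply (fderiv extremal_map x))"
      using extremal_map_invertible[OF b(1)] blinfun_inverse_bij by blast
    then show ?thesis
      using radial_starlike_condition[OF b(1) extremal_map_radial extremal_factor_derivative[OF b(1)]
          extremal_derivative_scaleC b(2) _ S \<alpha>(1)] extremal_derivative_nonzero(1)[OF b(1)]
      by (simp add: extremal_factor_def extremal_scalar_nonzero)
  qed
  ultimately show ?thesis by (simp add: starlike_maps_def)
qed

text \<open>The coefficients come from the differential equation p' (1 - w^2) = 2 (1 - \<alpha>) w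
  p. As P_1 = 0, only - P_2^2 remains of the determinant.\<close>

lemma extremal_map_H22: "cmod (H22 extremal_map T u) = (1 - \<alpha>)\<^sup>2"
proof -
  define P where "P = fps_expansion extremal_scalar 0"
  have hol: "extremal_scalar holomorphic_on ball 0 1"
    unfolding holomorphic_on_open[OF open_ball] using extremal_scalar_derivative by (metis mem_ball_0)
  have P: "extremal_scalar has_fps_expansion P"
    unfolding P_def by (rule has_fps_expansion_fps_expansion[of "ball 0 1"]) (use hol in auto)
  have dhol: "deriv extremal_scalar holomorphic_on ball 0 1" by (rule holomorphic_deriv[OF hol]) simp
  have "(\<lambda>w. deriv extremal_scalar w * (1 - w\<^sup>2)) has_fps_expansion fps_deriv P * (1 - fps_X\<^sup>2)"
    and "(\<lambda>w. 2 * of_real (1 - \<alpha>) * w * extremal_scalar w) has_fps_expansion fps_const (2 * of_real (1 - \<alpha>)) * fps_X * P"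
    using P by (auto intro!: fps_expansion_intros)
  then have "fps_deriv P * (1 - fps_X\<^sup>2) = fps_const (2 * of_real (1 - \<alpha>)) * fps_X * P"
  proof (rule fps_identity[rotated 3])
    fix w :: complex assume w: "w \<in> ball 0 1"
    then have "1 - w\<^sup>2 \<noteq> 0" using one_minus_square_not_nonpos[of w] by auto
    then show "deriv extremal_scalar w * (1 - w\<^sup>2) = 2 * of_real (1 - \<alpha>) * w * extremal_scalar w"
      using DERIV_imp_deriv[OF extremal_scalar_derivative[of w]] w by simp
  qed (use hol dhol in \<open>auto intro!: holomorphic_intros\<close>)
  then have nth: "fps_nth (fps_deriv P * (1 - fps_X\<^sup>2)) n =
      fps_nth (fps_const (2 * of_real (1 - \<alpha>)) * fps_X * P) n" for n
    by simp
  have P0: "fps_nth P 0 = 1" by (simp add: P_def fps_expansion_def extremal_scalar_def)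
  have P1: "fps_nth P 1 = 0"
    using nth[of 0] by simp
  have P2: "fps_nth P 2 = of_real (1 - \<alpha>)"
  proof -
    have "2 * fps_nth P 2 = 2 * of_real (1 - \<alpha>)"
      using nth[of 1] P0 by (simp add: fps_mult_nth numeral_2_eq_2 mult.assoc)
    then show ?thesis by (simp only: mult_cancel_left) simp
  qed
  have "T (z *\<^sub>C u) = z" for z
    using T u by (simp add: support_functionals_def)
  then have "H22 extremal_map T u = fps_nth P 1 * fps_nth P 3 - (fps_nth P 2)\<^sup>2"
    using H22_radial[OF extremal_map_holomorphic extremal_factor_holomorphic extremal_map_radial u T]
    by (simp add: extremal_factor_def P_def)
  then have "H22 extremal_map T u = - (of_real (1 - \<alpha>))\<^sup>2"
    unfolding P1 P2 by simp
  then show ?thesis using \<alpha> by (simp add: norm_power del: of_real_diff)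
qed

end

theorem theorem3p1:
  assumes nonzero: "\<exists>x::'a::complex_banach. x \<noteq> 0"
  shows "(\<forall>(\<alpha>::real) (g::'a \<Rightarrow> complex) (F::'a \<Rightarrow> 'a).
            0 \<le> \<alpha> \<and> \<alpha> < 1 \<and>
            frechet_holomorphic_on g (ball 0 1) \<and> g 0 = 1 \<and>
            (\<forall>x\<in>ball 0 1. F x = g x *\<^sub>C x) \<and> F \<in> starlike_maps \<alpha> \<longrightarrow>
            (\<forall>x\<^sub>0. norm x\<^sub>0 = 1 \<longrightarrow>
              (\<forall>T \<in> support_functionals x\<^sub>0. cmod (H22 F T x\<^sub>0) \<le> (1 - \<alpha>)\<^sup>2))) \<and>
         (\<forall>\<alpha>::real. 0 \<le> \<alpha> \<and> \<alpha> < 1 \<longrightarrow>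
            (\<exists>(F::'a \<Rightarrow> 'a) (g::'a \<Rightarrow> complex) (x\<^sub>0::'a).
              frechet_holomorphic_on g (ball 0 1) \<and> g 0 = 1 \<and>
              (\<forall>x\<in>ball 0 1. F x = g x *\<^sub>C x) \<and> F \<in> starlike_maps \<alpha> \<and>
              norm x\<^sub>0 = 1 \<and>
              (\<exists>T \<in> support_functionals x\<^sub>0. cmod (H22 F T x\<^sub>0) = (1 - \<alpha>)\<^sup>2)))"
proof (intro conjI allI impI ballI)
  fix \<alpha> :: real and g :: "'a \<Rightarrow> complex" and F :: "'a \<Rightarrow> 'a" and u :: 'a and T
  assume *: "0 \<le> \<alpha> \<and> \<alpha> < 1 \<and> frechet_holomorphic_on g (ball 0 1) \<and> g 0 = 1 \<and>
      (\<forall>x\<in>ball 0 1. F x = g x *\<^sub>C x) \<and> F \<in> starlike_maps \<alpha>"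
    and u: "norm u = 1" and T: "T \<in> support_functionals u"
  then have F: "frechet_holomorphic_on F (ball 0 1)"
    by (simp add: starlike_maps_def locally_biholomorphic_def)
  have ray: "g (z *\<^sub>C u) \<noteq> 0 \<and>
      Re ((g (z *\<^sub>C u) + z * deriv (\<lambda>z. g (z *\<^sub>C u)) z) / g (z *\<^sub>C u)) > \<alpha>" if "cmod z < 1" for z
    using * u that by (intro starlike_radial_ray[of g F]) auto
  have "cmod (fps_nth (fps_expansion (\<lambda>z. g (z *\<^sub>C u)) 0) 1 * fps_nth (fps_expansion (\<lambda>z. g (z *\<^sub>C u)) 0) 3
      - (fps_nth (fps_expansion (\<lambda>z. g (z *\<^sub>C u)) 0) 2)\<^sup>2) \<le> (1 - \<alpha>)\<^sup>2"
    by (rule hankel_bound) (use * ray holomorphic_scalar_ray[OF _ u] in \<open>auto simp: scaleC.zero_left\<close>)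
  then show "cmod (H22 F T u) \<le> (1 - \<alpha>)\<^sup>2"
    using H22_radial[OF F, of g u T] * u T by simp
next
  fix \<alpha> :: real assume \<alpha>: "0 \<le> \<alpha> \<and> \<alpha> < 1"
  obtain x :: 'a where "x \<noteq> 0" using nonzero by blast
  define u where "u = (1 / norm x) *\<^sub>R x"
  have u: "norm u = 1" using \<open>x \<noteq> 0\<close> by (simp add: u_def)
  then have "u \<noteq> 0" by auto
  then obtain T where T: "T \<in> support_functionals u" using support_functionals_nonempty by blast
  have "extremal_factor T \<alpha> 0 = 1"
    using \<alpha> by (simp add: extremal_factor_def[OF T u] extremal_scalar_def[OF T u])
  then show "\<exists>(F::'a \<Rightarrow> 'a) (g::'a \<Rightarrow> complex) (x\<^sub>0::'a).
      frechet_holomorphic_on g (ball 0 1) \<and> g 0 = 1 \<and>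
      (\<forall>x\<in>ball 0 1. F x = g x *\<^sub>C x) \<and> F \<in> starlike_maps \<alpha> \<and> norm x\<^sub>0 = 1 \<and>
      (\<exists>T \<in> support_functionals x\<^sub>0. cmod (H22 F T x\<^sub>0) = (1 - \<alpha>)\<^sup>2)"
    using extremal_factor_holomorphic[OF T u, of \<alpha>] extremal_map_radial[OF T u, of \<alpha>]
      extremal_map_starlike[OF T u, of \<alpha>] extremal_map_H22[OF T u, of \<alpha>] u T \<alpha> by blast
qed

end
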